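(* Consider one point target with complex reflectivity $\rho_0\neq 0$ at $\boldsymbol{y}_0=(x_0,y_0,0)$, a linear flight path with measurement positions $\boldsymbol{x}_n=(x_n,R,H)$, $x_n=-a/2+a(n-1)/(N-1)$, $n=1,\dots,N$, and let $L=\sqrt{R^2+H^2}$. Let $F_\epsilon$ be the signal subspace imaging functional $$F_{\epsilon}(\boldsymbol{y})=\frac1N\sum_{n=1}^N \mathbf{a}_n^*(\boldsymbol{y})\,U_n\Sigma_n^+U_n^*\,\mathbf{a}_n(\boldsymbol{y})$$ built from the data of this target, where $\mathbf{a}_n$, $U_n$, $\Sigma_n^+$ are as defined in the context, and let $\boldsymbol{y}=(x,y,0)$ be the search location. Assume that the signal-to-noise ratio is sufficiently high that the singular values corresponding to the signal subspace can be distinguished from those corresponding to the noise subspace. Then $1/F_\epsilon(\boldsymbol{y})$ attains a maximum of $|\rho_0|$ on $\boldsymbol{y}=\boldsymbol{y}_0$. Moreover, in the asymptotic limit $L\gg1$, $x_0/a\ll1$, $y_0/R\ll1$ and $\epsilon\ll1$, this image has a cross-range resolution $$\Delta x^*=O\!\left(\sqrt{\epsilon}\,\frac{c}{B}\,\frac{L}{a}\right)$$ and a range resolution $$\Delta y^*=O\!\left(\sqrt{\epsilon}\,\frac{c}{B}\,\frac{L}{R}\right).$$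
   Context: Geometry. The imaging region is planar, contained in $\{z=0\}$, with the origin at its center. The flight path is linear, parallel to the $x$-axis, with synthetic aperture $a>0$, and is offset from the origin by the range $R>0$ along the $y$-axis and by the height $H>0$ along the $z$-axis. Cross-range is the $x$-direction and range is the $y$-direction. $L=\sqrt{R^2+H^2}$ is the distance from the center of the flight path to the origin, and $L$ is assumed to be the largest length scale in the problem. $N\ge2$ is the number of measurement positions and $c>0$ is the wave speed. Frequencies. Let $M\ge 2$. The data are sampled at $2M-1$ equally spaced angular frequencies $\omega_m=\omega_1+(m-1)\Delta\omega$, $m=1,\dots,2M-1$. $B>0$ is the system bandwidth and $f_0$ its center frequency, $\omega_0=2\pi f_0$: the frequencies $\omega_1,\dots,\omega_M$ are $\omega_m=\omega_0\left[1+\beta\left(\frac{m-1}{M-1}-\frac12\right)\right]$ with $\beta=2\pi B/\omega_0$, so that $\Delta\omega=2\pi B/(M-1)$. Data. Under the Born approximation the measurement at $\boldsymbol{x}_n$ and frequency $\omega_m$ due to the target is $$d_n(\omega_m)=\rho_0\,\frac{e^{2\mathrm{i}\omega_m|\boldsymbol{x}_n-\boldsymbol{y}_0|/c}}{(4\pi|\boldsymbol{x}_n-\boldsymbol{y}_0|)^2}.$$ The Prony rearrangement is the $M\times M$ matrix $D_n$ with entries $(D_n)_{jk}=d_n(\omega_{j+k-1})$, $1\le j,k\le M$. It has rank one, with nonzero singular value $\sigma_0^{(n)}=M|\rho_0|/(4\pi|\boldsymbol{x}_n-\boldsymbol{y}_0|)^2$. Its singular value decomposition is $D_n=U_n\Sigma_nV_n^*$,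 singular values in decreasing order. The signal subspace corresponds to the first singular value and the noise subspace to the remaining ones. For a user-defined parameter $0<\epsilon<1$, $$\Sigma_n^+=\frac1{\sigma_0^{(n)}}\,\mathrm{diag}\left(1,\frac1\epsilon,\dots,\frac1\epsilon\right).$$ The signal-to-noise assumption means that the signal singular value (and its singular vectors) can be separated from the noise ones, so that $\Sigma_n^+$ is available in this form. Illumination vector: $$\mathbf{a}_n(\boldsymbol{y})=\frac1{4\pi|\boldsymbol{x}_n-\boldsymbol{y}|}\left(e^{2\mathrm{i}\omega_1|\boldsymbol{x}_n-\boldsymbol{y}|/c},\dots,e^{2\mathrm{i}\omega_M|\boldsymbol{x}_n-\boldsymbol{y}|/c}\right)^T.$$ Resolution. The image is the function $1/F_\epsilon$. Its cross-range resolution $\Delta x^*$ is the full-width/half-maximum quantity defined by $1/F_\epsilon(x_0+\Delta x^*,y_0)=1/(2|\rho_0|)^{-1}\cdot\frac{1}{1}=|\rho_0|/2$ (half of the peak value $|\rho_0|$), and its range resolution $\Delta y^*$ is defined by $1/F_\epsilon(x_0,y_0+\Delta y^* )=|\rho_0|/2$, where $F_\epsilon(x,y)$ stands for $F_\epsilon(\boldsymbol{y})$ with $\boldsymbol{y}=(x,y,0)$, and the solutions meant are those near the target.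
   Formalization: Because of geometric spreading, y_0 is not an exact maximum of 1/F_ε; what is proved: value |ρ_0| at y_0, the bound |ρ_0| max_n(|x_n-y|/|x_n-y_0|)² everywhere, and ≤(1+η)|ρ_0| asymptotically on regions about y_0 small compared with L. *)

theory Defs
  imports
    "HOL-Analysis.Product_Vector"
    "HOL-Library.Landau_Symbols"
    "Jordan_Normal_Form.Schur_Decomposition"
begin

(* Points of space are triples, whose library norm is the Euclidean one:
   (cross-range, range, height). *)
type_synonym point = "real \<times> real \<times> real"

record scene =
  apert :: real           (* a *)
  offs :: real            (* R *)
  height :: real          (* H *)
  npos :: nat             (* N *)
  speed :: real           (* c *)
  nfreq :: nat            (* M; the data use 2 M - 1 frequencies *)
  bandw :: real           (* B *)
  cfreq :: real           (* f_0 *)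
  tgt_x :: real           (* x_0 *)
  tgt_y :: real           (* y_0 *)
  reflectivity :: complex (* \<rho>_0 *)
  eps :: real             (* \<epsilon> *)

definition valid_scene :: "scene \<Rightarrow> bool" where
  "valid_scene P \<longleftrightarrow>
     apert P > 0 \<and> offs P > 0 \<and> height P > 0 \<and> npos P \<ge> 2 \<and> speed P > 0 \<and>
     nfreq P \<ge> 2 \<and> bandw P > 0 \<and> cfreq P > 0 \<and> reflectivity P \<noteq> 0 \<and> 0 < eps P \<and> eps P < 1"

definition Ldist :: "scene \<Rightarrow> real" where
  "Ldist P = sqrt ((offs P)\<^sup>2 + (height P)\<^sup>2)"

definition target :: "scene \<Rightarrow> point" where
  "target P = (tgt_x P, tgt_y P, 0)"

(* The index n runs over 1..N. *)
definition pos :: "scene \<Rightarrow> nat \<Rightarrow> point" where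
  "pos P n = (- apert P / 2 + apert P * (real n - 1) / (real (npos P) - 1), offs P, height P)"

definition omega0 :: "scene \<Rightarrow> real" where
  "omega0 P = 2 * pi * cfreq P"

(* Being affine in m, the formula for the M frequencies of the band also gives the
   remaining ones, M < m \<le> 2M-1, of the equally spaced grid. *)
definition omega :: "scene \<Rightarrow> nat \<Rightarrow> real" where
  "omega P m = omega0 P *
     (1 + (2 * pi * bandw P / omega0 P) * ((real m - 1) / (real (nfreq P) - 1) - 1/2))"

definition meas :: "scene \<Rightarrow> nat \<Rightarrow> nat \<Rightarrow> complex" where
  "meas P n m = reflectivity P *
     exp (2 * \<i> * complex_of_real (omega P m * dist (pos P n) (target P) / speed P)) /
     complex_of_real ((4 * pi * dist (pos P n) (target P))\<^sup>2)"

(* Matrix and vector indices start at 0: the 1-based entry d_n(omega_(j+k-1))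
   becomes d_n(omega_(j+k+1)). *)
definition prony :: "scene \<Rightarrow> nat \<Rightarrow> complex mat" where
  "prony P n = mat (nfreq P) (nfreq P) (\<lambda>(j, k). meas P n (j + k + 1))"

definition illum :: "scene \<Rightarrow> nat \<Rightarrow> point \<Rightarrow> complex vec" where
  "illum P n y = vec (nfreq P) (\<lambda>j.
     exp (2 * \<i> * complex_of_real (omega P (j + 1) * dist (pos P n) y / speed P)) /
     complex_of_real (4 * pi * dist (pos P n) y))"

definition diag_real :: "nat \<Rightarrow> (nat \<Rightarrow> real) \<Rightarrow> complex mat" where
  "diag_real m s = mat m m (\<lambda>(i, j). if i = j then complex_of_real (s i) else 0)"

definition unitary_mat :: "nat \<Rightarrow> complex mat \<Rightarrow> bool" where
  "unitary_mat m U \<longleftrightarrow> U \<in> carrier_mat m m \<and>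
     mat_adjoint U * U = 1\<^sub>m m \<and> U * mat_adjoint U = 1\<^sub>m m"

(* D = U diag(s) V^* with the singular values s 0 \<ge> s 1 \<ge> ... \<ge> s (m-1) \<ge> 0. *)
definition is_svd :: "nat \<Rightarrow> complex mat \<Rightarrow> complex mat \<Rightarrow> (nat \<Rightarrow> real) \<Rightarrow> complex mat \<Rightarrow> bool" where
  "is_svd m D U s V \<longleftrightarrow>
     unitary_mat m U \<and> unitary_mat m V \<and>
     (\<forall>j<m. s j \<ge> 0) \<and> (\<forall>j k. j \<le> k \<and> k < m \<longrightarrow> s k \<le> s j) \<and>
     D = U * diag_real m s * mat_adjoint V"

(* The rank-one signal part (first singular value) is separated from the noise part.
   For the data above this is a consequence of is_svd. *)
definition signal_separated :: "nat \<Rightarrow> (nat \<Rightarrow> real) \<Rightarrow> bool" where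
  "signal_separated m s \<longleftrightarrow> (\<forall>j. 1 \<le> j \<and> j < m \<longrightarrow> s j < s 0)"

definition Sigma_plus :: "scene \<Rightarrow> real \<Rightarrow> complex mat" where
  "Sigma_plus P s0 = diag_real (nfreq P) (\<lambda>j. (if j = 0 then 1 else 1 / eps P) / s0)"

(* Here (A *\<^sub>v a) \<bullet>c a is a^* A a. U n and s n are the left singular vectors and the
   singular values at position n; s n 0 is the nonzero singular value. *)
definition F_eps :: "scene \<Rightarrow> (nat \<Rightarrow> complex mat) \<Rightarrow> (nat \<Rightarrow> nat \<Rightarrow> real) \<Rightarrow> point \<Rightarrow> complex" where
  "F_eps P U s y = (1 / of_nat (npos P)) * (\<Sum>n = 1..npos P.
     ((U n * Sigma_plus P (s n 0) * mat_adjoint (U n)) *\<^sub>v illum P n y) \<bullet>c illum P n y)"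

lemma mat_adjoint_carrier:
  assumes "U \<in> carrier_mat m m"
  shows "mat_adjoint U \<in> carrier_mat m m"
  using assms by (auto simp: mat_adjoint_def)

lemma mat_adjoint_index:
  assumes "U \<in> carrier_mat m m" "i < m" "j < m"
  shows "mat_adjoint (U :: complex mat) $$ (i, j) = cnj (U $$ (j, i))"
  using assms by (auto simp: mat_adjoint_def mat_of_rows_def)

lemma quadform_diag:
  fixes U :: "complex mat" and a :: "complex vec"
  assumes U: "U \<in> carrier_mat m m" and a: "a \<in> carrier_vec m"
  shows "((U * diag_real m s * mat_adjoint U) *\<^sub>v a) \<bullet>c a =
    complex_of_real (\<Sum>k<m. s k * (cmod ((mat_adjoint U *\<^sub>v a) $ k))\<^sup>2)"
proof -
  define w where "w = mat_adjoint U *\<^sub>v a"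
  have A: "mat_adjoint U \<in> carrier_mat m m" using mat_adjoint_carrier[OF U] .
  have S: "diag_real m s \<in> carrier_mat m m" by (simp add: diag_real_def)
  have w: "w \<in> carrier_vec m" unfolding w_def using A a by simp
  have w_nth: "w $ k = (\<Sum>i<m. cnj (U $$ (i, k)) * a $ i)" if "k < m" for k
  proof -
    have "w $ k = (\<Sum>i = 0..<m. mat_adjoint U $$ (k, i) * a $ i)"
      using that carrier_matD[OF A] carrier_vecD[OF a] unfolding w_def
      by (simp add: scalar_prod_def)
    also have "\<dots> = (\<Sum>i<m. cnj (U $$ (i, k)) * a $ i)"
      using that by (auto simp: mat_adjoint_index[OF U] lessThan_atLeast0 intro!: sum.cong)
    finally show ?thesis .
  qed
  have Sw: "diag_real m s *\<^sub>v w = vec m (\<lambda>k. complex_of_real (s k) * w $ k)"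
  proof (rule eq_vecI)
    fix k assume "k < dim_vec (vec m (\<lambda>k. complex_of_real (s k) * w $ k))"
    then have k: "k < m" by simp
    have "(diag_real m s *\<^sub>v w) $ k =
        (\<Sum>i = 0..<m. (if k = i then complex_of_real (s k) else 0) * w $ i)"
      using k w by (simp add: diag_real_def scalar_prod_def)
    also have "\<dots> = (\<Sum>i = 0..<m. if k = i then complex_of_real (s k) * w $ i else 0)"
      by (rule sum.cong) auto
    also have "\<dots> = complex_of_real (s k) * w $ k" using k by simp
    finally show "(diag_real m s *\<^sub>v w) $ k = vec m (\<lambda>k. complex_of_real (s k) * w $ k) $ k"
      using k by simp
  qed (simp add: diag_real_def)
  have "(U * diag_real m s * mat_adjoint U) *\<^sub>v a = (U * diag_real m s) *\<^sub>v w"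
    unfolding w_def using assoc_mult_mat_vec[of "U * diag_real m s" m m "mat_adjoint U" m a] U S A a
    by simp
  also have "\<dots> = U *\<^sub>v (diag_real m s *\<^sub>v w)"
    using assoc_mult_mat_vec[OF U S w] .
  finally have *: "(U * diag_real m s * mat_adjoint U) *\<^sub>v a =
      U *\<^sub>v vec m (\<lambda>k. complex_of_real (s k) * w $ k)" using Sw by simp
  have "((U * diag_real m s * mat_adjoint U) *\<^sub>v a) \<bullet>c a =
      (\<Sum>i<m. (\<Sum>k<m. U $$ (i, k) * (complex_of_real (s k) * w $ k)) * cnj (a $ i))"
    unfolding * using U a by (simp add: scalar_prod_def lessThan_atLeast0)
  also have "\<dots> = (\<Sum>k<m. \<Sum>i<m. U $$ (i, k) * (complex_of_real (s k) * w $ k) * cnj (a $ i))"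
    unfolding sum_distrib_right by (rule sum.swap)
  also have "\<dots> = (\<Sum>k<m. complex_of_real (s k) * (w $ k * cnj (w $ k)))"
  proof (rule sum.cong)
    fix k assume "k \<in> {..<m}"
    then have "cnj (w $ k) = (\<Sum>i<m. U $$ (i, k) * cnj (a $ i))" by (simp add: w_nth)
    then show "(\<Sum>i<m. U $$ (i, k) * (complex_of_real (s k) * w $ k) * cnj (a $ i)) =
        complex_of_real (s k) * (w $ k * cnj (w $ k))"
      by (simp only: sum_distrib_left) (simp only: mult_ac)
  qed simp
  also have "\<dots> = complex_of_real (\<Sum>k<m. s k * (cmod (w $ k))\<^sup>2)"
    by (simp flip: complex_norm_square)
  finally show ?thesis unfolding w_def .
qed

(* F_eps takes real values, so the real part in the definition of the image loses nothing. *)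
lemma F_eps_real:
  assumes "\<And>n. n \<in> {1..npos P} \<Longrightarrow> U n \<in> carrier_mat (nfreq P) (nfreq P)"
  shows "F_eps P U s y \<in> \<real>"
proof -
  have "((U n * Sigma_plus P (s n 0) * mat_adjoint (U n)) *\<^sub>v illum P n y) \<bullet>c illum P n y \<in> \<real>"
    if "n \<in> {1..npos P}" for n
    unfolding Sigma_plus_def
    by (subst quadform_diag[OF assms[OF that]]) (simp_all add: illum_def)
  then show ?thesis unfolding F_eps_def
    by (intro Reals_mult Reals_divide sum_in_Reals) auto
qed

definition sar_image :: "scene \<Rightarrow> (nat \<Rightarrow> complex mat) \<Rightarrow> (nat \<Rightarrow> nat \<Rightarrow> real) \<Rightarrow> point \<Rightarrow> real" where
  "sar_image P U s y = Re (1 / F_eps P U s y)"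

(* t is the smallest positive solution of g t = h: for an image profile g that starts at its
   peak, this is the half-width at level h on the side along which g is taken. *)
definition first_hit :: "(real \<Rightarrow> real) \<Rightarrow> real \<Rightarrow> real \<Rightarrow> bool" where
  "first_hit g h t \<longleftrightarrow> 0 < t \<and> g t = h \<and> (\<forall>u. 0 < u \<and> u < t \<longrightarrow> g u \<noteq> h)"

(* The limit L >> 1, x_0/a << 1, y_0/R << 1, eps << 1 along a filter on a family of scenes.
   All parameters may vary; L is the largest length scale, the others being a and c/B. *)
definition asymptotic_regime :: "'i filter \<Rightarrow> ('i \<Rightarrow> scene) \<Rightarrow> bool" where
  "asymptotic_regime \<F> P \<longleftrightarrow>
     filterlim (\<lambda>i. Ldist (P i)) at_top \<F> \<and>
     (\<forall>\<^sub>F i in \<F>. apert (P i) \<le> Ldist (P i) \<and> speed (P i) / bandw (P i) \<le> Ldist (P i)) \<and>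
     ((\<lambda>i. tgt_x (P i) / apert (P i)) \<longlongrightarrow> 0) \<F> \<and>
     ((\<lambda>i. tgt_y (P i) / offs (P i)) \<longlongrightarrow> 0) \<F> \<and>
     ((\<lambda>i. eps (P i)) \<longlongrightarrow> 0) \<F>"

end

theory Submission
  imports Defs
begin

text \<open>The Prony matrix is \<open>\<kappa> v v\<^sup>T\<close>, so the signal direction is the steering vector \<open>v\<close> of the target
  and \<open>\<bar>\<rho>\<^sub>0\<bar> F\<^sub>\<epsilon>\<close> is the mean over \<open>n\<close> of \<open>(d\<^sub>n / r\<^sub>n)\<^sup>2 (1 + (1 / \<epsilon> - 1) (1 - S\<^sub>n))\<close>, where \<open>d\<^sub>n\<close> and \<open>r\<^sub>n\<close>
  are the distances from \<open>x\<^sub>n\<close> to the target and to the search point, and \<open>S\<^sub>n \<le> 1\<close> is a normalised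
  Dirichlet kernel of \<open>r\<^sub>n - d\<^sub>n\<close>.  Hence \<open>1 / F\<^sub>\<epsilon>\<close> exceeds \<open>\<bar>\<rho>\<^sub>0\<bar>\<close> at most by the geometric factor
  \<open>(r\<^sub>n / d\<^sub>n)\<^sup>2\<close>.  Near the target \<open>1 - S\<^sub>n\<close> is at least a multiple of \<open>(B (r\<^sub>n - d\<^sub>n) / c)\<^sup>2\<close>, so the image has
  dropped to half its peak once the mean square of \<open>r\<^sub>n - d\<^sub>n\<close> is a large multiple of \<open>\<epsilon> (c / B)\<^sup>2\<close>; by
  continuity the half-width is at most the displacement at which this happens.\<close>

section \<open>Coherence of equally spaced phases\<close>

text \<open>The Fejer kernel divided by \<open>M\<close>. It is the squared cosine of the angle
  between the steering vectors of the search point and of the target when \<open>\<theta>\<close> is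
  their phase mismatch per frequency step.\<close>

definition coh :: "nat \<Rightarrow> real \<Rightarrow> real" where
  "coh M \<theta> = (cmod ((\<Sum>j<M. cis (real j * \<theta>)) / of_nat M))\<^sup>2"

lemma coh_le_one: "coh M \<theta> \<le> 1"
proof -
  have "cmod (\<Sum>j<M. cis (real j * \<theta>)) \<le> real M"
    using sum_norm_le[of "{..<M}" "\<lambda>j. cis (real j * \<theta>)" "\<lambda>_. 1"] by simp
  then have "cmod ((\<Sum>j<M. cis (real j * \<theta>)) / of_nat M) \<le> 1"
    by (cases "M = 0") (simp_all add: norm_divide)
  then show ?thesis
    unfolding coh_def by (simp add: power_le_one)
qed

lemma coh_zero: "M > 0 \<Longrightarrow> coh M 0 = 1"
  by (simp add: coh_def)

text \<open>The numbers \<open>0, ..., M - 1\<close> have mean \<open>(M - 1) / 2\<close> and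
  variance \<open>(M^2 - 1) / 12\<close>. This serves both the frequency indices and the equally
  spaced flight positions.\<close>

lemma sum_sq_dev:
  "(\<Sum>k<M. (x - real k)\<^sup>2) =
    real M * (x - (real M - 1) / 2)\<^sup>2 + real M * ((real M)\<^sup>2 - 1) / 12"
proof (induction M)
  case (Suc M)
  then show ?case by (simp add: field_simps power2_eq_square)
qed simp

text \<open>Fourth-order Maclaurin expansion: since \<open>u^4 <= u^2\<close> here,
  \<open>1 - cos u >= u^2 / 2 - u^2 / 24\<close>, which is more than claimed.\<close>

lemma one_minus_cos_ge:
  fixes u :: real
  assumes "\<bar>u\<bar> \<le> 1"
  shows "u\<^sup>2 / 4 \<le> 1 - cos u"
proof -
  obtain t where t: "cos u = (\<Sum>m<4. cos_coeff m * u ^ m) + cos (t + 1/2 * real 4 * pi) / fact 4 * u ^ 4"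
    using Maclaurin_cos_expansion[of u 4] by blast
  have "cos (t + 1/2 * real 4 * pi) / fact 4 * u ^ 4 \<le> 1 / fact 4 * u ^ 4"
    by (intro mult_right_mono divide_right_mono) auto
  also have "\<dots> \<le> u\<^sup>2 / 24"
  proof -
    have "u\<^sup>2 \<le> 1" using assms by (simp add: abs_square_le_1)
    then have "u\<^sup>2 * u\<^sup>2 \<le> u\<^sup>2" by (intro mult_left_le) simp_all
    moreover have "u ^ 4 = u\<^sup>2 * u\<^sup>2" by (simp flip: power_add)
    ultimately have "u ^ 4 \<le> u\<^sup>2" by linarith
    then show ?thesis by (simp add: fact_numeral)
  qed
  moreover have "(\<Sum>m<4. cos_coeff m * u ^ m) = 1 - u\<^sup>2 / 2"
  proof -
    have "{..<4::nat} = {0, 1, 2, 3}" by auto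
    then show ?thesis by (simp add: cos_coeff_def)
  qed
  ultimately show ?thesis using t zero_le_power2[of u] by linarith
qed

lemma coh_eq_sum_cos:
  "coh M \<theta> = (\<Sum>j<M. \<Sum>k<M. cos ((real j - real k) * \<theta>)) / (real M)\<^sup>2"
proof -
  let ?z = "\<Sum>j<M. cis (real j * \<theta>)"
  have "complex_of_real ((cmod ?z)\<^sup>2) = ?z * cnj ?z"
    by (rule complex_norm_square)
  also have "\<dots> = (\<Sum>j<M. \<Sum>k<M. cis ((real j - real k) * \<theta>))"
    by (simp add: sum_product cis_cnj cis_mult algebra_simps)
  finally have "(cmod ?z)\<^sup>2 = Re (\<Sum>j<M. \<Sum>k<M. cis ((real j - real k) * \<theta>))"
    by (metis Re_complex_of_real)
  then show ?thesis
    by (simp add: coh_def norm_divide power_divide)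
qed

text \<open>No two phases differ by more than the total phase
  \<open>(M - 1) * \<bar>\<theta>\<bar>\<close>, so the quadratic cosine bound applies to every
  pair, and each row of squared index differences sums to at least \<open>M (M^2 - 1) / 12\<close>.
  The constant is 48 = 4 * 12; measuring by the total phase keeps it independent of
  \<open>M\<close>.\<close>

lemma one_minus_coh_ge:
  assumes M: "M \<ge> 2" and small: "(real M - 1) * \<bar>\<theta>\<bar> \<le> 1"
  shows "((real M - 1) * \<theta>)\<^sup>2 / 48 \<le> 1 - coh M \<theta>"
proof -
  have M2: "1 \<le> (real M)\<^sup>2" "1 \<le> real M" using M by auto
  have "(real M)\<^sup>2 * (((real M - 1) * \<theta>)\<^sup>2 / 48) \<le> (real M)\<^sup>2 * (((real M)\<^sup>2 - 1) * \<theta>\<^sup>2 / 48)"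
  proof -
    have "(real M - 1)\<^sup>2 \<le> (real M)\<^sup>2 - 1" using M2 by (simp add: power2_eq_square algebra_simps)
    then show ?thesis by (intro mult_left_mono) (auto simp: power_mult_distrib mult_right_mono)
  qed
  also have "\<dots> = (\<Sum>j<M. \<theta>\<^sup>2 / 4 * (real M * ((real M)\<^sup>2 - 1) / 12))"
    by (simp add: power2_eq_square)
  also have "\<dots> \<le> (\<Sum>j<M. \<theta>\<^sup>2 / 4 * (\<Sum>k<M. (real j - real k)\<^sup>2))"
    by (intro sum_mono mult_left_mono) (simp_all add: sum_sq_dev)
  also have "\<dots> = (\<Sum>j<M. \<Sum>k<M. ((real j - real k) * \<theta>)\<^sup>2 / 4)"
    by (simp add: sum_distrib_left power_mult_distrib mult_ac)
  also have "\<dots> \<le> (\<Sum>j<M. \<Sum>k<M. 1 - cos ((real j - real k) * \<theta>))"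
  proof (intro sum_mono one_minus_cos_ge)
    fix j k assume "j \<in> {..<M}" "k \<in> {..<M}"
    then have "\<bar>real j - real k\<bar> \<le> real M - 1" by auto
    then have "\<bar>real j - real k\<bar> * \<bar>\<theta>\<bar> \<le> (real M - 1) * \<bar>\<theta>\<bar>"
      by (intro mult_right_mono) auto
    then show "\<bar>(real j - real k) * \<theta>\<bar> \<le> 1" using small by (simp add: abs_mult)
  qed
  also have "\<dots> = (real M)\<^sup>2 * (1 - coh M \<theta>)"
    using M2 by (simp add: coh_eq_sum_cos sum_subtractf field_simps power2_eq_square)
  finally show ?thesis using M2 by simp
qed

section \<open>Distances, first crossings of a level, and quadratic equations for the
  displacement\<close>

lemma dist_triple_sq:
  fixes x :: real
  shows "(dist (x, y :: real, z :: real) (x', y', z'))\<^sup>2 = (x - x')\<^sup>2 + (y - y')\<^sup>2 + (z - z')\<^sup>2"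
  by (simp add: dist_Pair_Pair dist_real_def)

text \<open>The solutions in \<open>{0..b}\<close> form a compact set, nonempty by the intermediate
  value theorem, so there is a least one; \<open>h < g 0\<close> keeps it away from 0.\<close>

lemma first_hit_exists:
  fixes g :: "real \<Rightarrow> real"
  assumes "continuous_on {0..b} g" "0 \<le> b" "h < g 0" "g b \<le> h"
  shows "\<exists>t\<le>b. first_hit g h t"
proof -
  let ?S = "{0..b} \<inter> g -` {h}"
  have "\<exists>x\<ge>0. x \<le> b \<and> g x = h"
    using assms by (intro IVT2') auto
  then have "?S \<noteq> {}" by auto
  moreover have "compact ?S"
    using continuous_on_closed_vimage[of "{0..b}" g] assms(1)
    by (metis Int_commute closed_atLeastAtMost closed_singleton compact_Icc compact_Int_closed inf.idem inf_assoc)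
  ultimately obtain t where t: "t \<in> ?S" "\<forall>u\<in>?S. t \<le> u"
    using compact_attains_inf[of ?S] by blast
  have "t \<noteq> 0" using t assms by auto
  moreover have "g u \<noteq> h" if "0 < u" "u < t" for u
  proof
    assume "g u = h"
    then have "u \<in> ?S" using t(1) that by simp
    then have "t \<le> u" using t(2) by blast
    then show False using that by simp
  qed
  ultimately have "first_hit g h t"
    using t unfolding first_hit_def by auto
  then show ?thesis using t by auto
qed

text \<open>Prescribing \<open>W\<close> instead of \<open>t\<close> yields
  \<open>t * a <= W\<close> and \<open>t^2 <= W\<close> at once, so no case distinction on the size
  of \<open>t\<close> relative to \<open>a\<close> is needed.\<close>

lemma pos_quadratic_root:
  fixes a W :: real
  assumes "0 \<le> a" "0 < W"
  shows "\<exists>t>0. t * (t + a) = W"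
proof (intro exI conjI)
  let ?q = "sqrt (a\<^sup>2 + 4 * W)"
  have q: "?q * ?q = a\<^sup>2 + 4 * W" using assms by simp
  have "a < ?q" using assms by (intro real_less_rsqrt) auto
  then show "0 < (?q - a) / 2" by simp
  show "(?q - a) / 2 * ((?q - a) / 2 + a) = W"
    using q by (simp add: field_simps power2_eq_square)
qed

text \<open>For \<open>\<sigma> = 1\<close> the product \<open>t (t - 2 r)\<close> only reaches depth \<open>r\<^sup>2\<close> before it returns to \<open>0\<close> at the mirror
  point \<open>t = 2 r\<close>; if \<open>r\<^sup>2 < W\<close>, the root lies beyond that point.\<close>
lemma range_root:
  fixes r W \<sigma> :: real
  assumes r: "0 < r" and W: "0 < W" and \<sigma>: "\<sigma> \<in> {1, -1}"
  shows "\<exists>t>0. \<bar>t * (t - 2 * \<sigma> * r)\<bar> = W \<and> t * r \<le> 3 * W \<and> t\<^sup>2 \<le> 9 * W"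
proof -
  obtain u where u: "0 < u" "u * (u + 2 * r) = W"
    using pos_quadratic_root[of "2 * r" W] r W by auto
  have uu: "u * u + 2 * (u * r) = W" "0 < u * u" "0 < u * r" using u r by (simp_all add: algebra_simps)
  consider "\<sigma> = -1" | "\<sigma> = 1" "r\<^sup>2 \<le> W" | "\<sigma> = 1" "W \<le> r\<^sup>2" using \<sigma> by fastforce
  then show ?thesis
  proof cases
    case 1
    then have "u * (u - 2 * \<sigma> * r) = W" using u by simp
    moreover have "u * r \<le> 3 * W" "u\<^sup>2 \<le> 9 * W"
      using uu unfolding power2_eq_square by linarith+
    ultimately show ?thesis using u(1) W by (intro exI[of _ u]) simp
  next
    case 2
    \<comment> \<open>Beyond the mirror point, \<open>u * r <= W / 2\<close> and
      \<open>r^2 <= W\<close> bound both quantities.\<close>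
    have "(u + 2 * r) * r \<le> 3 * W" "(u + 2 * r)\<^sup>2 \<le> 9 * W"
      using uu 2 by (simp_all add: power2_eq_square algebra_simps)
    moreover have "(u + 2 * r) * (u + 2 * r - 2 * \<sigma> * r) = W" using u 2 by (simp add: mult.commute)
    then have "\<bar>(u + 2 * r) * (u + 2 * r - 2 * \<sigma> * r)\<bar> = W" using W by simp
    moreover have "0 < u + 2 * r" using u r by simp
    ultimately show ?thesis by blast
  next
    case 3
    \<comment> \<open>\<open>r - q\<close> is the smaller root of
      \<open>t * (2 * r - t) = W\<close>, reached before the product attains its extreme
      value.\<close>
    define q where "q = sqrt (r\<^sup>2 - W)"
    have q: "0 \<le> q" "q * q = r\<^sup>2 - W" using 3 by (simp_all add: q_def)
    have "q < r" unfolding q_def using W r by (intro real_less_lsqrt) auto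
    have eq: "(r - q) * (2 * r - (r - q)) = W" using q by (simp add: algebra_simps power2_eq_square)
    have rq: "(r - q) * r \<le> (r - q) * (2 * r - (r - q))" "(r - q) * (r - q) \<le> (r - q) * r"
      using \<open>q < r\<close> q by (simp_all add: mult_left_mono)
    have "(r - q) * (r - q - 2 * \<sigma> * r) = - W" using eq 3 by (simp add: algebra_simps)
    then have "\<bar>(r - q) * (r - q - 2 * \<sigma> * r)\<bar> = W" using W by simp
    moreover have "(r - q) * r \<le> 3 * W" "(r - q)\<^sup>2 \<le> 9 * W"
      using rq eq W unfolding power2_eq_square by linarith+
    moreover have "0 < r - q" using \<open>q < r\<close> by simp
    ultimately show ?thesis by blast
  qed
qed

section \<open>Symmetric rank-one matrices\<close>

lemma diag_real_index:
  "i < m \<Longrightarrow> j < m \<Longrightarrow> diag_real m s $$ (i, j) = (if i = j then complex_of_real (s i) else 0)"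
  by (simp add: diag_real_def)

lemma diag_real_carrier: "diag_real m s \<in> carrier_mat m m"
  by (simp add: diag_real_def)

lemma mult_mat_index:
  assumes "A \<in> carrier_mat m m" "B \<in> carrier_mat m m" "i < m" "j < m"
  shows "(A * B) $$ (i, j) = (\<Sum>k<m. A $$ (i, k) * B $$ (k, j))"
  using assms by (auto simp: scalar_prod_def lessThan_atLeast0 intro!: sum.cong)

lemma unitary_mat_carrier: "unitary_mat m U \<Longrightarrow> U \<in> carrier_mat m m"
  by (simp add: unitary_mat_def)

lemma adjoint_mult_vec_index:
  assumes "U \<in> carrier_mat m m" "a \<in> carrier_vec m" "k < m"
  shows "(mat_adjoint U *\<^sub>v a) $ k = (\<Sum>i<m. cnj (U $$ (i, k)) * a $ i)"
proof -
  have "(mat_adjoint U *\<^sub>v a) $ k = (\<Sum>i = 0..<m. mat_adjoint U $$ (k, i) * a $ i)"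
    using assms mat_adjoint_carrier[OF assms(1)] by (simp add: scalar_prod_def)
  also have "\<dots> = (\<Sum>i<m. cnj (U $$ (i, k)) * a $ i)"
    using assms by (auto simp: mat_adjoint_index[OF assms(1)] lessThan_atLeast0 intro!: sum.cong)
  finally show ?thesis .
qed

lemma unitary_columns_orthonormal:
  assumes U: "unitary_mat m U" and "j < m" "k < m"
  shows "(\<Sum>i<m. cnj (U $$ (i, j)) * U $$ (i, k)) = (if j = k then 1 else 0)"
proof -
  have UC: "U \<in> carrier_mat m m" using U by (rule unitary_mat_carrier)
  have "(mat_adjoint U * U) $$ (j, k) = (\<Sum>i<m. mat_adjoint U $$ (j, i) * U $$ (i, k))"
    using assms UC by (intro mult_mat_index mat_adjoint_carrier) auto
  then show ?thesis
    using U assms(2,3) by (simp add: unitary_mat_def mat_adjoint_index[OF UC])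
qed

text \<open>The diagonal quadratic form with all weights one is that of
  \<open>U U^* = 1\<close>.\<close>

lemma unitary_parseval:
  assumes U: "unitary_mat m U" and a: "a \<in> carrier_vec m"
  shows "(\<Sum>k<m. (cmod (\<Sum>i<m. cnj (U $$ (i, k)) * a $ i))\<^sup>2) = (\<Sum>i<m. (cmod (a $ i))\<^sup>2)"
proof -
  have UC: "U \<in> carrier_mat m m" using U by (rule unitary_mat_carrier)
  have one: "diag_real m (\<lambda>_. 1) = 1\<^sub>m m" by (auto simp: diag_real_def)
  have "U * diag_real m (\<lambda>_. 1) * mat_adjoint U = 1\<^sub>m m"
    using U UC by (simp add: one unitary_mat_def)
  then have "complex_of_real (\<Sum>k<m. 1 * (cmod ((mat_adjoint U *\<^sub>v a) $ k))\<^sup>2) = a \<bullet>c a"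
    using quadform_diag[OF UC a, of "\<lambda>_. 1"] a by simp
  also have "\<dots> = (\<Sum>i<m. a $ i * cnj (a $ i))"
    using a by (simp add: scalar_prod_def lessThan_atLeast0)
  also have "\<dots> = complex_of_real (\<Sum>i<m. (cmod (a $ i))\<^sup>2)"
    by (simp flip: complex_norm_square)
  finally have "(\<Sum>k<m. 1 * (cmod ((mat_adjoint U *\<^sub>v a) $ k))\<^sup>2) = (\<Sum>i<m. (cmod (a $ i))\<^sup>2)"
    by (simp only: of_real_eq_iff)
  then show ?thesis
    by (simp add: adjoint_mult_vec_index[OF UC a])
qed

text \<open>The columns of \<open>U\<close> belonging to positive singular values are proportional to \<open>v\<close>; being
  orthogonal, there is only one of them.\<close>
lemma rank_one_svd:
  fixes v :: "nat \<Rightarrow> complex"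
  assumes svd: "is_svd m (mat m m (\<lambda>(j, k). \<kappa> * v j * v k)) U s V"
    and sep: "signal_separated m s" and m: "m \<ge> 2" and v: "\<And>i. cmod (v i) = 1"
  shows "s 0 = real m * cmod \<kappa> \<and> s 0 > 0 \<and>
    (\<exists>\<gamma>. (cmod \<gamma>)\<^sup>2 * real m = 1 \<and> (\<forall>i<m. U $$ (i, 0) = \<gamma> * v i))"
proof -
  define D where "D = mat m m (\<lambda>(j, k). \<kappa> * v j * v k)"
  define z where "z j = (\<Sum>k<m. v k * V $$ (k, j))" for j
  have U: "unitary_mat m U" and V: "unitary_mat m V" and nonneg: "\<And>j. j < m \<Longrightarrow> s j \<ge> 0"
    and D: "D = U * diag_real m s * mat_adjoint V"
    using svd by (auto simp: is_svd_def D_def)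
  have UC: "U \<in> carrier_mat m m" and VC: "V \<in> carrier_mat m m"
    using U V by (auto intro: unitary_mat_carrier)
  have DC: "D \<in> carrier_mat m m" by (simp add: D_def)
  note SC = diag_real_carrier[of m s]
  \<comment> \<open>Multiplying by \<open>V\<close> on the right turns the decomposition into one
    equation per column.\<close>
  have "D * V = U * diag_real m s * (mat_adjoint V * V)"
    unfolding D by (rule assoc_mult_mat[OF mult_carrier_mat[OF UC SC] mat_adjoint_carrier[OF VC] VC])
  also have "\<dots> = U * diag_real m s"
    using V right_mult_one_mat[OF mult_carrier_mat[OF UC SC]] by (simp add: unitary_mat_def)
  finally have DV: "D * V = U * diag_real m s" .
  have col: "of_real (s j) * U $$ (i, j) = \<kappa> * v i * z j" if "i < m" "j < m" for i j
  proof -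
    have "(D * V) $$ (i, j) = (\<Sum>k<m. \<kappa> * v i * v k * V $$ (k, j))"
      using that by (subst mult_mat_index[OF DC VC]) (auto simp: D_def)
    moreover have "(U * diag_real m s) $$ (i, j) =
        (\<Sum>k<m. if k = j then U $$ (i, k) * of_real (s k) else 0)"
      unfolding mult_mat_index[OF UC SC that]
      using that by (intro sum.cong) (simp_all add: diag_real_index)
    ultimately show ?thesis
      using DV that by (simp add: z_def sum_distrib_left mult_ac)
  qed
  have norm_col: "(\<Sum>i<m. (cmod (U $$ (i, j)))\<^sup>2) = 1" if "j < m" for j
  proof -
    have "complex_of_real (\<Sum>i<m. (cmod (U $$ (i, j)))\<^sup>2) = 1"
      using unitary_columns_orthonormal[OF U that that]
      by (simp add: complex_norm_square mult.commute del: of_real_power)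
    then show ?thesis by (simp only: of_real_eq_1_iff)
  qed
  have sz: "(s j)\<^sup>2 = (cmod \<kappa>)\<^sup>2 * real m * (cmod (z j))\<^sup>2" if j: "j < m" for j
  proof -
    have "(s j)\<^sup>2 = (\<Sum>i<m. (cmod (of_real (s j) * U $$ (i, j)))\<^sup>2)"
      using norm_col[OF j] by (simp add: norm_mult power_mult_distrib flip: sum_distrib_left)
    also have "\<dots> = (\<Sum>i<m. (cmod \<kappa>)\<^sup>2 * (cmod (z j))\<^sup>2)"
      using j by (intro sum.cong) (auto simp: col norm_mult power_mult_distrib v)
    finally show ?thesis by simp
  qed
  \<comment> \<open>\<open>m >= 2\<close> supplies the index 1, and separation gives
    \<open>s 0 > s 1 >= 0\<close>.\<close>
  have s0: "s 0 > 0" using sep m nonneg[of 1] by (force simp: signal_separated_def)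
  have \<kappa>: "\<kappa> \<noteq> 0" and z0: "z 0 \<noteq> 0" using sz[of 0] s0 m by auto
  have Ucol: "U $$ (i, j) = (\<kappa> * z j / of_real (s j)) * v i" if "i < m" "j < m" "s j \<noteq> 0" for i j
    using col[OF that(1,2)] that(3) by (simp add: field_simps)
  have zj: "z j = 0" if j: "0 < j" "j < m" for j
  proof (rule ccontr)
    assume "z j \<noteq> 0"
    then have sj: "s j \<noteq> 0" using sz[OF j(2)] \<kappa> m by auto
    have "0 = (\<Sum>i<m. cnj (U $$ (i, 0)) * U $$ (i, j))"
      using unitary_columns_orthonormal[OF U _ j(2), of 0] j by simp
    also have "\<dots> = (\<Sum>i<m. cnj (\<kappa> * z 0 / of_real (s 0)) * (\<kappa> * z j / of_real (s j)))"
    proof (intro sum.cong refl)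
      fix i assume i: "i \<in> {..<m}"
      have "cnj (v i) * v i = 1"
        using complex_norm_square[of "v i"] by (simp add: v mult.commute)
      then show "cnj (U $$ (i, 0)) * U $$ (i, j) =
          cnj (\<kappa> * z 0 / of_real (s 0)) * (\<kappa> * z j / of_real (s j))"
        using Ucol[of i 0] Ucol[of i j] i j s0 sj m
        by (simp add: mult_ac)
    qed
    also have "\<dots> \<noteq> 0" using \<kappa> z0 \<open>z j \<noteq> 0\<close> s0 sj m by simp
    finally show False by simp
  qed
  \<comment> \<open>The matrix is symmetric, not Hermitian, so the right singular direction is the
    conjugate of \<open>v\<close>: the conjugates of the \<open>z j\<close> are its coordinates in
    the basis of columns of \<open>V\<close>.\<close>
  have "(\<Sum>j<m. (cmod (z j))\<^sup>2) = real m"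
  proof -
    have "cmod (\<Sum>i<m. cnj (V $$ (i, k)) * cnj (v i)) = cmod (z k)" for k
    proof -
      have "(\<Sum>i<m. cnj (V $$ (i, k)) * cnj (v i)) = cnj (z k)"
        by (simp add: z_def mult.commute)
      then show ?thesis by simp
    qed
    then show ?thesis
      using unitary_parseval[OF V, of "vec m (\<lambda>i. cnj (v i))"] by (simp add: v)
  qed
  moreover have "(\<Sum>j<m. (cmod (z j))\<^sup>2) = (cmod (z 0))\<^sup>2"
    using m zj by (subst sum.remove[of _ 0]) (auto intro!: sum.neutral)
  ultimately have "(cmod (z 0))\<^sup>2 = real m" by simp
  then have "(s 0)\<^sup>2 = (real m * cmod \<kappa>)\<^sup>2" using sz[of 0] m by (simp add: power2_eq_square)
  then have "s 0 = real m * cmod \<kappa>" using s0 by (simp add: power2_eq_iff_nonneg)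
  moreover define \<gamma> where "\<gamma> = \<kappa> * z 0 / of_real (s 0)"
  have \<gamma>: "\<forall>i<m. U $$ (i, 0) = \<gamma> * v i" unfolding \<gamma>_def using Ucol[of _ 0] s0 m by simp
  moreover have "(cmod \<gamma>)\<^sup>2 * real m = 1"
    using norm_col[of 0] m \<gamma> by (simp add: norm_mult v mult.commute)
  ultimately show ?thesis using s0 by blast
qed

text \<open>Only column 0 of \<open>U\<close> is known, and only up to a phase. Parseval gives the
  contribution of the others as total minus first, so the result does not depend on which
  decomposition was chosen.\<close>

lemma rank_one_quadform:
  fixes v :: "nat \<Rightarrow> complex"
  assumes svd: "is_svd m (mat m m (\<lambda>(j, k). \<kappa> * v j * v k)) U s V"
    and sep: "signal_separated m s" and m: "m \<ge> 2" and v: "\<And>i. cmod (v i) = 1"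
    and a: "a \<in> carrier_vec m"
  shows "((U * diag_real m (\<lambda>j. (if j = 0 then 1 else b) / s 0) * mat_adjoint U) *\<^sub>v a) \<bullet>c a =
    complex_of_real ((b * (\<Sum>i<m. (cmod (a $ i))\<^sup>2) -
      (b - 1) * (cmod (\<Sum>i<m. cnj (v i) * a $ i))\<^sup>2 / real m) / (real m * cmod \<kappa>))"
proof -
  have U: "unitary_mat m U" using svd by (simp add: is_svd_def)
  have UC: "U \<in> carrier_mat m m" using U by (rule unitary_mat_carrier)
  obtain \<gamma> where s0: "s 0 = real m * cmod \<kappa>" "s 0 > 0" and \<gamma>: "(cmod \<gamma>)\<^sup>2 * real m = 1"
    and col: "\<And>i. i < m \<Longrightarrow> U $$ (i, 0) = \<gamma> * v i"
    using rank_one_svd[OF svd sep m v] by blast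
  define w where "w k = (\<Sum>i<m. cnj (U $$ (i, k)) * a $ i)" for k
  have "w 0 = (\<Sum>i<m. cnj \<gamma> * (cnj (v i) * a $ i))"
    unfolding w_def by (intro sum.cong) (auto simp: col)
  then have w0: "(cmod (w 0))\<^sup>2 = (cmod (\<Sum>i<m. cnj (v i) * a $ i))\<^sup>2 / real m"
    using \<gamma> m by (simp add: norm_mult power_mult_distrib field_simps flip: sum_distrib_left)
  have w: "(\<Sum>k<m. (cmod (w k))\<^sup>2) = (\<Sum>i<m. (cmod (a $ i))\<^sup>2)"
    unfolding w_def by (rule unitary_parseval[OF U a])
  have "(\<Sum>k<m. (if k = 0 then 1 else b) / s 0 * (cmod (w k))\<^sup>2) =
      (\<Sum>k<m. b / s 0 * (cmod (w k))\<^sup>2 - (if k = 0 then (b - 1) / s 0 * (cmod (w k))\<^sup>2 else 0))"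
    by (intro sum.cong) (auto simp: algebra_simps diff_divide_distrib)
  also have "\<dots> = (b * (\<Sum>k<m. (cmod (w k))\<^sup>2) - (b - 1) * (cmod (w 0))\<^sup>2) / s 0"
    using m by (simp add: sum_subtractf sum_distrib_left sum_divide_distrib left_diff_distrib
        diff_divide_distrib)
  finally show ?thesis
    using quadform_diag[OF UC a, of "\<lambda>j. (if j = 0 then 1 else b) / s 0"]
    by (simp add: adjoint_mult_vec_index[OF UC a] w0 w flip: s0(1) w_def)
qed

section \<open>The imaging functional\<close>

text \<open>Mismatch of the round-trip phase per frequency step,
  \<open>2 \<Delta>\<omega> (r - d) / c\<close> with
  \<open>\<Delta>\<omega> = 2 \<pi> B / (M - 1)\<close>.\<close>

definition phase :: "scene \<Rightarrow> nat \<Rightarrow> point \<Rightarrow> real" where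
  "phase P n y = 4 * pi * bandw P * (dist (pos P n) y - dist (pos P n) (target P)) /
     (speed P * (real (nfreq P) - 1))"

text \<open>Closed form of \<open>\<bar>\<rho>\<^sub>0\<bar> F\<^sub>\<epsilon>\<close>, in which no
  singular vectors occur.\<close>

definition misfit :: "scene \<Rightarrow> point \<Rightarrow> real" where
  "misfit P y = (\<Sum>n = 1..npos P. (dist (pos P n) (target P) / dist (pos P n) y)\<^sup>2 *
     (1 + (1 / eps P - 1) * (1 - coh (nfreq P) (phase P n y)))) / real (npos P)"

lemma omega_Suc:
  assumes "valid_scene P"
  shows "omega P (Suc j) = omega P 1 + real j * (2 * pi * bandw P / (real (nfreq P) - 1))"
  using assms by (simp add: omega_def omega0_def valid_scene_def field_simps)

lemma exp_2i: "exp (2 * \<i> * complex_of_real x) = cis (2 * x)"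
  by (simp add: cis_conv_exp mult_ac)

lemma dist_pos_ground:
  assumes "valid_scene P"
  shows "0 < dist (pos P n) (x, y, 0)"
  using assms by (auto simp: pos_def valid_scene_def)

lemma dist_pos_target: "valid_scene P \<Longrightarrow> 0 < dist (pos P n) (target P)"
  unfolding target_def by (rule dist_pos_ground)

text \<open>The frequencies are affine in their index, hence
  \<open>\<phi> (j + k) = \<phi> j + \<phi> k - \<phi> 0\<close> and the exponential
  factorises.\<close>

lemma prony_rank_one:
  fixes n :: nat
  assumes P: "valid_scene P"
  defines "d \<equiv> dist (pos P n) (target P)"
  defines "\<phi> \<equiv> \<lambda>j. 2 * (omega P (Suc j) * d / speed P)"
  shows "prony P n = mat (nfreq P) (nfreq P) (\<lambda>(j, k).
    reflectivity P * cis (- \<phi> 0) / complex_of_real ((4 * pi * d)\<^sup>2) * cis (\<phi> j) * cis (\<phi> k))"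
proof -
  have "\<phi> (j + k) = - \<phi> 0 + \<phi> j + \<phi> k" for j k
    using omega_Suc[OF P, of "j + k"] omega_Suc[OF P, of j] omega_Suc[OF P, of k]
    by (simp add: \<phi>_def algebra_simps add_divide_distrib)
  then have "cis (\<phi> (j + k)) = cis (- \<phi> 0) * cis (\<phi> j) * cis (\<phi> k)" for j k
    by (simp only: cis_mult)
  moreover have "meas P n (j + k + 1) =
      reflectivity P * cis (\<phi> (j + k)) / complex_of_real ((4 * pi * d)\<^sup>2)" for j k
    unfolding meas_def exp_2i d_def[symmetric] \<phi>_def by simp
  ultimately have "meas P n (j + k + 1) = reflectivity P * cis (- \<phi> 0) /
      complex_of_real ((4 * pi * d)\<^sup>2) * cis (\<phi> j) * cis (\<phi> k)" for j k
    by (simp only: times_divide_eq_left mult.assoc)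
  then show ?thesis by (simp add: prony_def)
qed

lemma F_eps_eq:
  assumes P: "valid_scene P"
    and svd: "\<And>n. n \<in> {1..npos P} \<Longrightarrow> is_svd (nfreq P) (prony P n) (U n) (s n) (V n)"
    and snr: "\<And>n. n \<in> {1..npos P} \<Longrightarrow> signal_separated (nfreq P) (s n)"
  shows "F_eps P U s (x, y, 0) =
    complex_of_real (misfit P (x, y, 0) / cmod (reflectivity P))"
proof -
  let ?y = "(x, y, 0) :: point"
  let ?M = "nfreq P"
  have term_eq: "((U n * Sigma_plus P (s n 0) * mat_adjoint (U n)) *\<^sub>v illum P n ?y) \<bullet>c illum P n ?y =
    complex_of_real ((dist (pos P n) (target P) / dist (pos P n) ?y)\<^sup>2 *
      (1 + (1 / eps P - 1) * (1 - coh ?M (phase P n ?y))) / cmod (reflectivity P))"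
    if n: "n \<in> {1..npos P}" for n
  proof -
    define d where "d = dist (pos P n) (target P)"
    define r where "r = dist (pos P n) ?y"
    define \<phi> where "\<phi> = (\<lambda>j. 2 * (omega P (Suc j) * d / speed P))"
    define \<kappa> where "\<kappa> = reflectivity P * cis (- \<phi> 0) / complex_of_real ((4 * pi * d)\<^sup>2)"
    have dr: "0 < d" "0 < r"
      unfolding d_def r_def using dist_pos_target[OF P] dist_pos_ground[OF P] by auto
    have M: "?M \<ge> 2" "real ?M > 0" and \<rho>: "0 < cmod (reflectivity P)"
      using P by (auto simp: valid_scene_def)
    have \<kappa>: "cmod \<kappa> = cmod (reflectivity P) / (4 * pi * d)\<^sup>2"
      by (simp add: \<kappa>_def norm_divide norm_mult norm_power power_mult_distrib)
    have "prony P n = mat ?M ?M (\<lambda>(j, k). \<kappa> * cis (\<phi> j) * cis (\<phi> k))"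
      using prony_rank_one[OF P] by (simp add: \<kappa>_def \<phi>_def d_def)
    then have svd': "is_svd ?M (mat ?M ?M (\<lambda>(j, k). \<kappa> * cis (\<phi> j) * cis (\<phi> k))) (U n) (s n) (V n)"
      using svd[OF n] by simp
    have a: "illum P n ?y \<in> carrier_vec ?M" by (simp add: illum_def)
    have a_nth: "illum P n ?y $ i =
        cis (2 * (omega P (Suc i) * r / speed P)) / complex_of_real (4 * pi * r)" if "i < ?M" for i
      using that unfolding illum_def exp_2i by (simp add: r_def)
    have norm_a: "(\<Sum>i<?M. (cmod (illum P n ?y $ i))\<^sup>2) = real ?M / (4 * pi * r)\<^sup>2"
      using dr by (simp add: a_nth norm_divide norm_mult power_divide)
    \<comment> \<open>The phase at the first frequency is common to all entries and disappears when
      the modulus of the projection is taken.\<close>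
    define \<psi> where "\<psi> = 2 * (omega P 1 * (r - d) / speed P)"
    have entry: "cnj (cis (\<phi> i)) * illum P n ?y $ i =
        cis \<psi> / complex_of_real (4 * pi * r) * cis (real i * phase P n ?y)" if i: "i < ?M" for i
    proof -
      have "- \<phi> i + 2 * (omega P (Suc i) * r / speed P) = \<psi> + real i * phase P n ?y"
      proof -
        define X where "X = 2 * pi * bandw P / (real ?M - 1)"
        have "omega P (Suc i) = omega P 1 + real i * X" unfolding X_def by (rule omega_Suc[OF P])
        moreover have "phase P n ?y = 2 * (X * (r - d) / speed P)"
          by (simp add: phase_def X_def r_def d_def mult_ac)
        moreover have "- \<phi> i + 2 * (omega P (Suc i) * r / speed P) = 2 * (omega P (Suc i) * (r - d) / speed P)"
          by (simp add: \<phi>_def right_diff_distrib diff_divide_distrib)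
        ultimately show ?thesis
          by (simp add: \<psi>_def distrib_right add_divide_distrib)
      qed
      then show ?thesis
        using i by (simp add: a_nth cis_cnj cis_mult)
    qed
    have "(\<Sum>i<?M. cnj (cis (\<phi> i)) * illum P n ?y $ i) =
        cis \<psi> / complex_of_real (4 * pi * r) * (\<Sum>i<?M. cis (real i * phase P n ?y))"
      using entry by (simp add: sum_distrib_left)
    then have proj: "(cmod (\<Sum>i<?M. cnj (cis (\<phi> i)) * illum P n ?y $ i))\<^sup>2 =
        (real ?M)\<^sup>2 * coh ?M (phase P n ?y) / (4 * pi * r)\<^sup>2"
      using dr M by (simp add: coh_def norm_mult norm_divide power_divide power_mult_distrib)
    \<comment> \<open>To be read with \<open>b = 1 / \<epsilon>\<close>, \<open>m = M\<close>,
      \<open>q = 4 \<pi> r\<close>, \<open>t = 4 \<pi> d\<close>, \<open>C\<close> the coherence and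
      \<open>g\<close> the modulus of the reflectivity: the amplitudes of the illumination vector
      and of the singular value combine into \<open>(d / r)^2\<close>.\<close>
    have alg: "(b * (m / q\<^sup>2) - (b - 1) * (m\<^sup>2 * C / q\<^sup>2) / m) / (m * (g / t\<^sup>2)) =
        (t / q)\<^sup>2 * (1 + (b - 1) * (1 - C)) / g"
      if "m > 0" "q > 0" "t > 0" "g > 0" for b m q C g t :: real
    proof -
      have "b * (m * w) - (b - 1) * (m * C * w) = m * (1 + (b - 1) * (1 - C)) * w" for w
        by (simp add: algebra_simps)
      from this[of "1 / q\<^sup>2"]
      have "b * (m / q\<^sup>2) - (b - 1) * (m * C / q\<^sup>2) = m * (1 + (b - 1) * (1 - C)) / q\<^sup>2"
        by simp
      moreover have "(b - 1) * (m\<^sup>2 * C / q\<^sup>2) / m = (b - 1) * (m * C / q\<^sup>2)"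
        using that by (simp add: power2_eq_square)
      ultimately show ?thesis using that by (simp add: power_divide)
    qed
    have ratio: "(4 * pi * d) / (4 * pi * r) = d / r" by simp
    have pos: "4 * pi * r > 0" "4 * pi * d > 0" using dr by auto
    have v: "cmod (cis (\<phi> i)) = 1" for i by simp
    note quad = rank_one_quadform[OF svd' snr[OF n] M(1) v a, of "1 / eps P"]
    show ?thesis
      unfolding Sigma_plus_def quad norm_a proj \<kappa> d_def[symmetric] r_def[symmetric]
        alg[OF M(2) pos \<rho>] ratio by (rule refl)
  qed
  define T where "T n = (dist (pos P n) (target P) / dist (pos P n) ?y)\<^sup>2 *
      (1 + (1 / eps P - 1) * (1 - coh ?M (phase P n ?y)))" for n
  have "(\<Sum>n = 1..npos P. ((U n * Sigma_plus P (s n 0) * mat_adjoint (U n)) *\<^sub>v illum P n ?y) \<bullet>c illum P n ?y)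
      = complex_of_real (\<Sum>n = 1..npos P. T n / cmod (reflectivity P))"
    unfolding of_real_sum T_def by (rule sum.cong[OF refl term_eq])
  moreover have "(\<Sum>n = 1..npos P. T n / cmod (reflectivity P)) =
      real (npos P) * (misfit P ?y / cmod (reflectivity P))"
    using P by (simp add: misfit_def valid_scene_def T_def flip: sum_divide_distrib)
  ultimately have "(\<Sum>n = 1..npos P. ((U n * Sigma_plus P (s n 0) * mat_adjoint (U n)) *\<^sub>v illum P n ?y)
      \<bullet>c illum P n ?y) = complex_of_real (real (npos P) * (misfit P ?y / cmod (reflectivity P)))"
    by (simp only:)
  then show ?thesis
    unfolding F_eps_def using P by (simp add: valid_scene_def)
qed

text \<open>As \<open>\<epsilon> < 1\<close> and the coherence is at most one, the noise-subspace
  term is nonnegative, and each summand is at least its geometric factor.\<close>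

lemma misfit_ge:
  assumes P: "valid_scene P"
  shows "1 / (MAX n\<in>{1..npos P}. (dist (pos P n) (x, y, 0) / dist (pos P n) (target P))\<^sup>2)
    \<le> misfit P (x, y, 0)"
proof -
  let ?q = "\<lambda>n. (dist (pos P n) (x, y, 0) / dist (pos P n) (target P))\<^sup>2"
  let ?m = "MAX n\<in>{1..npos P}. ?q n"
  have N: "real (npos P) > 0" and e: "0 < eps P" "eps P < 1" using P by (auto simp: valid_scene_def)
  have q: "0 < ?q n" for n using dist_pos_ground[OF P, of n] dist_pos_target[OF P, of n] by simp
  have "1 / ?m \<le> (dist (pos P n) (target P) / dist (pos P n) (x, y, 0))\<^sup>2 *
      (1 + (1 / eps P - 1) * (1 - coh (nfreq P) (phase P n (x, y, 0))))" if "n \<in> {1..npos P}" for n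
  proof -
    have "?q n \<le> ?m" using that by (intro Max_ge) auto
    then have "1 / ?m \<le> 1 / ?q n" using q[of n] by (simp add: frac_le)
    also have "\<dots> = (dist (pos P n) (target P) / dist (pos P n) (x, y, 0))\<^sup>2"
      by (simp add: power_divide)
    also have "\<dots> \<le> (dist (pos P n) (target P) / dist (pos P n) (x, y, 0))\<^sup>2 *
      (1 + (1 / eps P - 1) * (1 - coh (nfreq P) (phase P n (x, y, 0))))"
      using e coh_le_one[of "nfreq P"] by (simp add: mult_le_cancel_left1)
    finally show ?thesis .
  qed
  then have "(\<Sum>n = 1..npos P. 1 / ?m) \<le> (\<Sum>n = 1..npos P. (dist (pos P n) (target P) / dist (pos P n) (x, y, 0))\<^sup>2 *
      (1 + (1 / eps P - 1) * (1 - coh (nfreq P) (phase P n (x, y, 0)))))"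
    by (rule sum_mono)
  then show ?thesis
    unfolding misfit_def using N by (simp add: field_simps)
qed

lemma Max_ratio_pos:
  assumes P: "valid_scene P"
  shows "0 < (MAX n\<in>{1..npos P}. (dist (pos P n) (x, y, 0) / dist (pos P n) (target P))\<^sup>2)"
proof -
  have "1 \<in> {1..npos P}" using P by (auto simp: valid_scene_def)
  then have "(dist (pos P 1) (x, y, 0) / dist (pos P 1) (target P))\<^sup>2 \<le>
      (MAX n\<in>{1..npos P}. (dist (pos P n) (x, y, 0) / dist (pos P n) (target P))\<^sup>2)"
    by (intro Max_ge) auto
  moreover have "0 < (dist (pos P 1) (x, y, 0) / dist (pos P 1) (target P))\<^sup>2"
    using dist_pos_ground[OF P] dist_pos_target[OF P] by simp
  ultimately show ?thesis by linarith
qed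

lemma misfit_pos:
  assumes "valid_scene P"
  shows "0 < misfit P (x, y, 0)"
proof -
  have "0 < 1 / (MAX n\<in>{1..npos P}. (dist (pos P n) (x, y, 0) / dist (pos P n) (target P))\<^sup>2)"
    using Max_ratio_pos[OF assms, of x y] by simp
  then show ?thesis using misfit_ge[OF assms] by (rule less_le_trans)
qed

lemma misfit_target:
  assumes P: "valid_scene P"
  shows "misfit P (target P) = 1"
proof -
  have "phase P n (target P) = 0" for n by (simp add: phase_def)
  then show ?thesis
    using P dist_pos_target[OF P] by (auto simp: misfit_def coh_zero valid_scene_def less_le)
qed

lemma continuous_on_coh [continuous_intros]:
  assumes "continuous_on S f"
  shows "continuous_on S (\<lambda>t. coh M (f t))"
  unfolding coh_def using assms by (cases "M = 0") (auto intro!: continuous_intros)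

lemma continuous_on_misfit:
  assumes P: "valid_scene P" and "continuous_on S f" "continuous_on S g"
  shows "continuous_on S (\<lambda>t. misfit P (f t, g t, 0))"
proof -
  have "dist (pos P n) (f t, g t, 0) \<noteq> 0" for n t
    using dist_pos_ground[OF P, of n "f t" "g t"] by linarith
  moreover have "speed P * (real (nfreq P) - 1) \<noteq> 0" "real (npos P) \<noteq> 0"
    using P by (auto simp: valid_scene_def)
  ultimately show ?thesis
    unfolding misfit_def phase_def using assms(2,3)
    by (intro continuous_intros) auto
qed

lemma sar_image_eq:
  assumes "valid_scene P"
    and "\<And>n. n \<in> {1..npos P} \<Longrightarrow> is_svd (nfreq P) (prony P n) (U n) (s n) (V n)"
    and "\<And>n. n \<in> {1..npos P} \<Longrightarrow> signal_separated (nfreq P) (s n)"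
  shows "sar_image P U s (x, y, 0) = cmod (reflectivity P) / misfit P (x, y, 0)"
proof -
  have "1 / F_eps P U s (x, y, 0) =
      complex_of_real (cmod (reflectivity P) / misfit P (x, y, 0))"
    using F_eps_eq[of P U s V x y] assms by simp
  then show ?thesis unfolding sar_image_def by (simp only: Re_complex_of_real)
qed

section \<open>Resolution\<close>

text \<open>\<open>r\<^sup>2 - d\<^sup>2 = (r - d) (r + d)\<close> turns differences of distances, on which the misfit depends, into
  polynomials in the displacement, and \<open>r + d\<close> is of order \<open>L\<close>.  With \<open>W\<close> of order
  \<open>\<surd>\<epsilon> L c / B\<close> the phases are of order \<open>\<surd>\<epsilon>\<close>, which \<open>1 / \<epsilon>\<close> amplifies to order one.\<close>
lemma misfit_ge_two:
  fixes x y :: real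
  assumes P: "valid_scene P"
    and aL: "apert P \<le> Ldist P" and cL: "speed P / bandw P \<le> Ldist P"
    and x0: "\<bar>tgt_x P\<bar> \<le> apert P / 8" and y0: "\<bar>tgt_y P\<bar> \<le> offs P / 2"
    and e: "sqrt (eps P) \<le> 1 / 10000"
  defines "W \<equiv> 40 * (sqrt (eps P) * (speed P / bandw P) * Ldist P)"
  assumes near: "(dist (x, y, 0) (target P))\<^sup>2 \<le> 9 * W"
    and up: "\<And>n. n \<in> {1..npos P} \<Longrightarrow>
      \<bar>(dist (pos P n) (x, y, 0))\<^sup>2 - (dist (pos P n) (target P))\<^sup>2\<bar> \<le> 2 * W"
    and low: "real (npos P) * W\<^sup>2 / 8 \<le>
      (\<Sum>n = 1..npos P. ((dist (pos P n) (x, y, 0))\<^sup>2 - (dist (pos P n) (target P))\<^sup>2)\<^sup>2)"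
  shows "2 \<le> misfit P (x, y, 0)"
proof -
  define L where "L = Ldist P"
  define k where "k = speed P / bandw P"
  define h where "h = sqrt (eps P)"
  define M where "M = nfreq P"
  define d where "d n = dist (pos P n) (target P)" for n
  define r where "r n = dist (pos P n) (x, y, 0)" for n
  have pos: "0 < apert P" "0 < offs P" "0 < height P" "2 \<le> npos P" "0 < speed P" "2 \<le> M" "0 < bandw P"
    "0 < eps P" "eps P < 1"
    using P by (auto simp: valid_scene_def M_def)
  have L2: "L\<^sup>2 = (offs P)\<^sup>2 + (height P)\<^sup>2" by (simp add: L_def Ldist_def)
  have L: "0 < L" using pos by (simp add: L_def Ldist_def sum_power2_gt_zero_iff)
  have k: "0 < k" "k \<le> L" using pos cL by (simp_all add: k_def L_def)
  have h: "0 < h" "h\<^sup>2 = eps P" "h \<le> 1 / 10000" using pos e by (simp_all add: h_def)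
  have W: "W = 40 * (h * k * L)" by (simp add: W_def h_def k_def L_def)
  have Wpos: "0 < W" using h k L by (simp add: W)
  \<comment> \<open>The flight positions lie within \<open>a / 2\<close> of the centre. With the
    bounds on the target, \<open>d^2\<close> lies between \<open>L^2 / 4\<close> and
    \<open>13 / 4 * L^2\<close>.\<close>
  have d: "L / 2 \<le> d n" "d n \<le> 2 * L" if n: "n \<in> {1..npos P}" for n
  proof -
    define p where "p = - apert P / 2 + apert P * (real n - 1) / (real (npos P) - 1)"
    define f where "f = (real n - 1) / (real (npos P) - 1)"
    have "0 \<le> f" "f \<le> 1" using n pos by (auto simp: f_def)
    then have "0 \<le> apert P * f" "apert P * f \<le> apert P"
      using pos by (simp_all add: mult_left_le)
    moreover have "p = - apert P / 2 + apert P * f" by (simp add: p_def f_def)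
    ultimately have p: "\<bar>p\<bar> \<le> apert P / 2" unfolding abs_le_iff by linarith
    have d2: "(d n)\<^sup>2 = (p - tgt_x P)\<^sup>2 + (offs P - tgt_y P)\<^sup>2 + (height P)\<^sup>2"
      unfolding d_def pos_def target_def dist_triple_sq p_def by simp
    have "(offs P / 2)\<^sup>2 \<le> (offs P - tgt_y P)\<^sup>2" "(offs P - tgt_y P)\<^sup>2 \<le> (3 / 2 * offs P)\<^sup>2"
      using y0 pos by (auto intro!: power_mono)
    then have o: "(offs P)\<^sup>2 / 4 \<le> (offs P - tgt_y P)\<^sup>2" "(offs P - tgt_y P)\<^sup>2 \<le> 9 / 4 * (offs P)\<^sup>2"
      by (simp_all add: power_divide power_mult_distrib)
    have "\<bar>p - tgt_x P\<bar> \<le> L" using p x0 aL unfolding L_def by linarith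
    then have xx: "(p - tgt_x P)\<^sup>2 \<le> L\<^sup>2" by (metis abs_ge_zero power2_abs power_mono)
    have "(L / 2)\<^sup>2 = L\<^sup>2 / 4" "(2 * L)\<^sup>2 = 4 * L\<^sup>2"
      by (simp_all add: power_divide power_mult_distrib)
    note bounds = this o xx L2 d2 zero_le_power2[of "p - tgt_x P"] zero_le_power2[of "height P"]
      zero_le_power2[of "offs P"]
    have "(L / 2)\<^sup>2 \<le> (d n)\<^sup>2" using bounds by linarith
    then show "L / 2 \<le> d n" by (rule power2_le_imp_le) (simp add: d_def)
    have "(d n)\<^sup>2 \<le> (2 * L)\<^sup>2" using bounds by linarith
    then show "d n \<le> 2 * L" by (rule power2_le_imp_le) (use L in simp)
  qed
  define \<tau> where "\<tau> = dist (x, y, 0) (target P)"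
  \<comment> \<open>\<open>9 * W = 360 * h * k * L\<close>, and \<open>h <= 1 / 10000\<close> with
    \<open>k <= L\<close> make this at most \<open>0.036 * L^2\<close>, below
    \<open>L^2 / 16\<close>.\<close>
  have "\<tau>\<^sup>2 \<le> (L / 4)\<^sup>2"
  proof -
    have "h * k * L \<le> 1 / 10000 * L * L" using h k L by (intro mult_mono) auto
    moreover have "(L / 4)\<^sup>2 = L * L / 16" by (simp add: power2_eq_square)
    moreover have "\<tau>\<^sup>2 \<le> 9 * (40 * (h * k * L))" using near unfolding \<tau>_def W .
    ultimately show ?thesis using mult_pos_pos[OF L L] by linarith
  qed
  then have \<tau>: "\<tau> \<le> L / 4" by (rule power2_le_imp_le) (use L in simp)
  have rd: "\<bar>r n - d n\<bar> \<le> L / 4" for n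
    using \<tau> dist_triangle[of "pos P n" "(x, y, 0)" "target P"]
      dist_triangle[of "pos P n" "target P" "(x, y, 0)"] dist_commute[of "target P" "(x, y, 0)"]
    unfolding \<tau>_def r_def d_def abs_le_iff by linarith
  have r: "L / 4 \<le> r n" "r n + d n \<le> 5 * L" "L / 2 \<le> r n + d n" "(4 :: real) / 9 \<le> (d n / r n)\<^sup>2"
    if n: "n \<in> {1..npos P}" for n
  proof -
    have "r n - d n \<le> L / 4" "d n - r n \<le> L / 4" using rd[of n] unfolding abs_le_iff by linarith+
    note bounds = this d[OF n] L
    show "L / 4 \<le> r n" "r n + d n \<le> 5 * L" "L / 2 \<le> r n + d n" using bounds by linarith+
    have "2 * r n \<le> 3 * d n" "0 < r n" using bounds by linarith+
    then have "2 / 3 \<le> d n / r n" by (simp add: field_simps)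
    then have "(2 / 3)\<^sup>2 \<le> (d n / r n)\<^sup>2" by (intro power_mono) auto
    then show "(4 :: real) / 9 \<le> (d n / r n)\<^sup>2" by (simp add: power_divide)
  qed
  define \<Delta> where "\<Delta> n = (r n)\<^sup>2 - (d n)\<^sup>2" for n
  \<comment> \<open>The total phase mismatch across the band, in which \<open>M\<close>
    cancels.\<close>
  define \<psi> where "\<psi> n = (real M - 1) * phase P n (x, y, 0)" for n
  have \<psi>: "\<psi> n = 4 * pi * \<Delta> n / (k * (r n + d n))" if n: "n \<in> {1..npos P}" for n
  proof -
    have "r n + d n \<noteq> 0" using r[OF n] L by simp
    then have "\<Delta> n / (r n + d n) = r n - d n"
      by (simp add: \<Delta>_def power2_eq_square field_simps)
    moreover have "\<psi> n = 4 * pi * (r n - d n) / k"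
      using pos by (simp add: \<psi>_def phase_def k_def flip: M_def r_def d_def)
    moreover have "4 * pi * \<Delta> n / (k * (r n + d n)) = 4 * pi * (\<Delta> n / (r n + d n)) / k"
      by (simp add: mult.commute)
    ultimately show ?thesis by (simp only:)
  qed
  have pi: "2 \<le> pi" "pi \<le> 4" using pi_ge_two pi_less_4 by auto
  \<comment> \<open>The upper bound on \<open>\<Delta>\<close> keeps the total phase at most
    \<open>2560 * h\<close>, hence below one, where the coherence estimate applies.\<close>
  have coh: "(\<psi> n)\<^sup>2 / 48 \<le> 1 - coh M (phase P n (x, y, 0))" if n: "n \<in> {1..npos P}" for n
  proof -
    have "k * (L / 2) \<le> k * (r n + d n)" using r[OF n] k by simp
    moreover have "4 * pi * \<bar>\<Delta> n\<bar> \<le> 16 * (2 * W)"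
      using up[OF n] pi by (intro mult_mono) (auto simp: \<Delta>_def r_def d_def)
    moreover have "0 < k * (L / 2)" using k L by simp
    ultimately have "4 * pi * \<bar>\<Delta> n\<bar> / (k * (r n + d n)) \<le> 16 * (2 * W) / (k * (L / 2))"
      using Wpos by (intro frac_le) simp_all
    moreover have "\<bar>\<psi> n\<bar> = 4 * pi * \<bar>\<Delta> n\<bar> / (k * (r n + d n))"
      unfolding \<psi>[OF n] using r(3)[OF n] k L by (simp add: abs_mult)
    ultimately have "\<bar>\<psi> n\<bar> \<le> 16 * (2 * W) / (k * (L / 2))" by (simp only:)
    also have "\<dots> = 2560 * h" using k L by (simp add: W)
    also have "\<dots> \<le> 1" using h by simp
    finally have "\<bar>\<psi> n\<bar> \<le> 1" .
    then show ?thesis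
      using one_minus_coh_ge[of M "phase P n (x, y, 0)"] pos by (simp add: \<psi>_def abs_mult)
  qed
  have low\<psi>: "64 * (\<Delta> n)\<^sup>2 / (k * (5 * L))\<^sup>2 \<le> (\<psi> n)\<^sup>2" if n: "n \<in> {1..npos P}" for n
  proof -
    have "k * (r n + d n) \<le> k * (5 * L)" using r[OF n] k by simp
    then have "(k * (r n + d n))\<^sup>2 \<le> (k * (5 * L))\<^sup>2"
      using r[OF n] k L by (intro power_mono) auto
    moreover have "(4 * 2)\<^sup>2 \<le> (4 * pi)\<^sup>2" using pi by (intro power_mono) auto
    then have "64 * (\<Delta> n)\<^sup>2 \<le> (4 * pi)\<^sup>2 * (\<Delta> n)\<^sup>2" by (intro mult_right_mono) auto
    ultimately show ?thesis
      unfolding \<psi>[OF n] power_divide power_mult_distrib[of "4 * pi"]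
      using r[OF n] k L by (intro frac_le) auto
  qed
  have e2: "1 / (2 * h\<^sup>2) \<le> 1 / eps P - 1"
  proof -
    have "h\<^sup>2 \<le> (1 / 10000)\<^sup>2" using h by (intro power_mono) auto
    then show ?thesis using h pos by (simp add: field_simps power2_eq_square)
  qed
  have summand: "4 / 9 * (1 / (2 * h\<^sup>2) * (64 * (\<Delta> n)\<^sup>2 / (k * (5 * L))\<^sup>2 / 48)) \<le>
      (d n / r n)\<^sup>2 * (1 + (1 / eps P - 1) * (1 - coh M (phase P n (x, y, 0))))"
    if n: "n \<in> {1..npos P}" for n
  proof -
    have "64 * (\<Delta> n)\<^sup>2 / (k * (5 * L))\<^sup>2 / 48 \<le> 1 - coh M (phase P n (x, y, 0))"
      by (rule order_trans[OF divide_right_mono[OF low\<psi>[OF n]] coh[OF n]]) simp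
    then have "1 / (2 * h\<^sup>2) * (64 * (\<Delta> n)\<^sup>2 / (k * (5 * L))\<^sup>2 / 48) \<le>
        (1 / eps P - 1) * (1 - coh M (phase P n (x, y, 0)))"
      using e2 pos by (intro mult_mono) auto
    then show ?thesis
      using r(4)[OF n] by (intro mult_mono) auto
  qed
  have N: "0 < real (npos P)" using pos by simp
  \<comment> \<open>The factor 40 in \<open>W\<close> is chosen for this: the right-hand side equals
    \<open>64 / 27\<close> per position, independently of \<open>h\<close>, \<open>k\<close> and
    \<open>L\<close>.\<close>
  have "2 * real (npos P) \<le> 4 / 9 * (1 / (2 * h\<^sup>2) * (64 * (real (npos P) * W\<^sup>2 / 8) / (k * (5 * L))\<^sup>2 / 48))"
    using h(1) k L N by (simp add: W power_mult_distrib field_simps)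
  also have "\<dots> \<le> 4 / 9 * (1 / (2 * h\<^sup>2) * (64 * (\<Sum>n = 1..npos P. (\<Delta> n)\<^sup>2) / (k * (5 * L))\<^sup>2 / 48))"
    using low unfolding \<Delta>_def r_def d_def
    by (intro mult_left_mono divide_right_mono) auto
  also have "\<dots> = (\<Sum>n = 1..npos P. 4 / 9 * (1 / (2 * h\<^sup>2) * (64 * (\<Delta> n)\<^sup>2 / (k * (5 * L))\<^sup>2 / 48)))"
    by (simp only: sum_distrib_left sum_divide_distrib)
  also have "\<dots> \<le> (\<Sum>n = 1..npos P. (d n / r n)\<^sup>2 *
      (1 + (1 / eps P - 1) * (1 - coh M (phase P n (x, y, 0)))))"
    by (rule sum_mono) (rule summand)
  finally show ?thesis
    using N by (simp add: misfit_def field_simps flip: M_def r_def d_def)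
qed

text \<open>Here \<open>r\<^sub>n\<^sup>2 - d\<^sub>n\<^sup>2 = t (t - 2 \<sigma> (x\<^sub>n - x\<^sub>0))\<close> may vanish at individual positions, but its mean square
  over the aperture is at least \<open>t\<^sup>2\<close> times the variance of \<open>2 x\<^sub>n\<close>.\<close>
lemma misfit_cross_range:
  assumes P: "valid_scene P"
    and aL: "apert P \<le> Ldist P" and cL: "speed P / bandw P \<le> Ldist P"
    and x0: "\<bar>tgt_x P\<bar> \<le> apert P / 8" and y0: "\<bar>tgt_y P\<bar> \<le> offs P / 2"
    and e: "sqrt (eps P) \<le> 1 / 10000"
    and \<sigma>: "\<sigma> \<in> {1, -1 :: real}"
  defines "q \<equiv> sqrt (eps P) * (speed P / bandw P)"
  shows "\<exists>t>0. t \<le> 40 * (q * (Ldist P / apert P)) \<and>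
    2 \<le> misfit P (tgt_x P + \<sigma> * t, tgt_y P, 0)"
proof -
  define W where "W = 40 * (q * Ldist P)"
  define a where "a = apert P"
  have pos: "0 < a" "0 < offs P" "2 \<le> npos P" "0 < speed P" "0 < bandw P" "0 < eps P"
    using P by (auto simp: valid_scene_def a_def)
  have \<sigma>2: "\<sigma> * \<sigma> = 1" "\<bar>\<sigma>\<bar> = 1" using \<sigma> by auto
  have "0 < Ldist P" using pos by (simp add: Ldist_def add_pos_nonneg)
  then have W: "0 < W" using pos by (simp add: W_def q_def)
  \<comment> \<open>Since the offsets \<open>u n\<close> are bounded by \<open>a\<close>,
    \<open>t + a\<close> is up to a factor 2 the largest possible value of
    \<open>\<bar>t - 2 * \<sigma> * u n\<bar>\<close>; the equation also yields
    \<open>t <= W / a\<close>.\<close>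
  obtain t where t: "0 < t" "t * (t + a) = W" using pos_quadratic_root[of a W] W pos by auto
  have tt: "0 < t * t" "0 < t * a" "t * t + t * a = W" using t pos by (simp_all add: algebra_simps)
  define h where "h = a / (real (npos P) - 1)"
  have h: "0 < h" "h * (real (npos P) - 1) = a" using pos by (simp_all add: h_def)
  define u where "u n = - a / 2 + h * (real n - 1) - tgt_x P" for n
  have \<Delta>: "(dist (pos P n) (tgt_x P + \<sigma> * t, tgt_y P, 0))\<^sup>2 - (dist (pos P n) (target P))\<^sup>2 =
      t * (t - 2 * \<sigma> * u n)" for n
  proof -
    have "pos P n = (u n + tgt_x P, offs P, height P)"
      by (simp add: pos_def u_def h_def a_def)
    then have "(dist (pos P n) (tgt_x P + \<sigma> * t, tgt_y P, 0))\<^sup>2 - (dist (pos P n) (target P))\<^sup>2 =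
        (u n - \<sigma> * t)\<^sup>2 - (u n)\<^sup>2"
      unfolding target_def by (simp add: dist_triple_sq)
    also have "\<dots> = (\<sigma> * \<sigma>) * t * t - 2 * \<sigma> * t * u n"
      by (simp add: power2_eq_square algebra_simps)
    finally show ?thesis using \<sigma>2 by (simp add: algebra_simps)
  qed
  have u: "\<bar>u n\<bar> \<le> a" if n: "n \<in> {1..npos P}" for n
  proof -
    have "0 \<le> h * (real n - 1)" "h * (real n - 1) \<le> a"
      using n h mult_left_mono[of "real n - 1" "real (npos P) - 1" h] by auto
    then show ?thesis using x0 unfolding u_def a_def abs_le_iff by linarith
  qed
  have near: "(dist (tgt_x P + \<sigma> * t, tgt_y P, 0) (target P))\<^sup>2 \<le> 9 * W"
  proof -
    have "(dist (tgt_x P + \<sigma> * t, tgt_y P, 0) (target P))\<^sup>2 = (\<sigma> * \<sigma>) * t * t"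
      unfolding target_def dist_triple_sq by (simp add: power2_eq_square algebra_simps)
    then show ?thesis using tt \<sigma>2 by simp
  qed
  have up: "\<bar>t * (t - 2 * \<sigma> * u n)\<bar> \<le> 2 * W" if n: "n \<in> {1..npos P}" for n
  proof -
    have "\<bar>t - 2 * \<sigma> * u n\<bar> \<le> \<bar>t\<bar> + \<bar>2 * \<sigma> * u n\<bar>" by (rule abs_triangle_ineq4)
    also have "\<dots> \<le> 2 * (t + a)" using u[OF n] t \<sigma>2 by (simp add: abs_mult)
    finally have "t * \<bar>t - 2 * \<sigma> * u n\<bar> \<le> t * (2 * (t + a))" using t by (intro mult_left_mono) auto
    moreover have "\<bar>t * (t - 2 * \<sigma> * u n)\<bar> = t * \<bar>t - 2 * \<sigma> * u n\<bar>" using t by (simp add: abs_mult)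
    moreover have "t * (2 * (t + a)) = 2 * W" unfolding t(2)[symmetric] by (rule mult.left_commute)
    ultimately show ?thesis by linarith
  qed
  have low: "real (npos P) * W\<^sup>2 / 8 \<le> (\<Sum>n = 1..npos P. (t * (t - 2 * \<sigma> * u n))\<^sup>2)"
  proof -
    define N where "N = real (npos P)"
    have N: "2 \<le> N" "h * (N - 1) = a" using pos h by (simp_all add: N_def)
    \<comment> \<open>The fractional position index, counted from 0, at which
      \<open>t - 2 * \<sigma> * u\<close> would vanish.\<close>
    define X where "X = (\<sigma> * t / 2 + a / 2 + tgt_x P) / h"
    have hX: "h * X = \<sigma> * t / 2 + a / 2 + tgt_x P" using h by (simp add: X_def)
    have sq: "(t - 2 * \<sigma> * u (Suc k))\<^sup>2 = 4 * h\<^sup>2 * (X - real k)\<^sup>2" for k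
    proof -
      have "2 * \<sigma> * (h * X - h * real k) = (\<sigma> * \<sigma>) * t - 2 * \<sigma> * u (Suc k)"
        unfolding hX u_def by (simp add: algebra_simps)
      then have "(t - 2 * \<sigma> * u (Suc k))\<^sup>2 = (2 * \<sigma> * (h * X - h * real k))\<^sup>2" using \<sigma>2 by simp
      also have "\<dots> = (\<sigma> * \<sigma>) * (4 * h\<^sup>2 * (X - real k)\<^sup>2)"
        by (simp add: power2_eq_square algebra_simps)
      finally show ?thesis using \<sigma>2 by simp
    qed
    have "(\<Sum>n = 1..npos P. (t - 2 * \<sigma> * u n)\<^sup>2) = (\<Sum>k<npos P. (t - 2 * \<sigma> * u (Suc k))\<^sup>2)"
      by (rule sum.reindex_bij_witness[of _ Suc "\<lambda>n. n - 1"]) auto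
    also have "\<dots> = 4 * h\<^sup>2 * (N * (X - (N - 1) / 2)\<^sup>2 + N * (N\<^sup>2 - 1) / 12)"
      unfolding sq N_def by (simp only: sum_sq_dev flip: sum_distrib_left)
    also have "\<dots> = N * (2 * (h * X) - h * (N - 1))\<^sup>2 + N * (h * (N - 1)) * (h * (N - 1) + 2 * h) / 3"
      by (simp add: power2_eq_square field_simps)
    also have "\<dots> = N * ((\<sigma> * t + 2 * tgt_x P)\<^sup>2 + a * (a + 2 * h) / 3)"
    proof -
      have "2 * (h * X) - a = \<sigma> * t + 2 * tgt_x P" unfolding hX by simp
      then show ?thesis unfolding N(2) by (simp add: algebra_simps)
    qed
    finally have eq: "(\<Sum>n = 1..npos P. (t - 2 * \<sigma> * u n)\<^sup>2) =
        N * ((\<sigma> * t + 2 * tgt_x P)\<^sup>2 + a * (a + 2 * h) / 3)" .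
    \<comment> \<open>Squared mean plus variance. With \<open>\<bar>tgt_x P\<bar> <= a / 8\<close>
      the sum is at least \<open>t^2 / 2 + (1/3 - 1/16) * a^2\<close>, which exceeds
      \<open>(t^2 + a^2) / 4\<close> and hence \<open>(t + a)^2 / 8\<close>.\<close>
    have "(t + a)\<^sup>2 / 8 \<le> (\<sigma> * t + 2 * tgt_x P)\<^sup>2 + a * (a + 2 * h) / 3"
    proof -
      have sq1: "(\<sigma> * t)\<^sup>2 = t\<^sup>2" using \<sigma>2 by (simp add: power_mult_distrib power2_eq_square)
      have "2 * (\<sigma> * t + 2 * tgt_x P)\<^sup>2 + 2 * (2 * tgt_x P)\<^sup>2 - (\<sigma> * t)\<^sup>2 = (\<sigma> * t + 4 * tgt_x P)\<^sup>2"
        by (simp add: power2_eq_square algebra_simps)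
      then have s1: "t\<^sup>2 / 2 - (2 * tgt_x P)\<^sup>2 \<le> (\<sigma> * t + 2 * tgt_x P)\<^sup>2"
        using sq1 zero_le_power2[of "\<sigma> * t + 4 * tgt_x P"] by linarith
      have "(2 * \<bar>tgt_x P\<bar>)\<^sup>2 \<le> (a / 4)\<^sup>2" using x0 by (intro power_mono) (auto simp: a_def)
      then have s2: "(2 * tgt_x P)\<^sup>2 \<le> a\<^sup>2 / 16" by (simp add: power_mult_distrib power_divide)
      have s3: "a\<^sup>2 / 3 \<le> a * (a + 2 * h) / 3" using pos h by (simp add: power2_eq_square algebra_simps)
      have s4: "(t + a)\<^sup>2 \<le> 2 * t\<^sup>2 + 2 * a\<^sup>2"
        using zero_le_power2[of "t - a"] by (simp add: power2_eq_square algebra_simps)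
      show ?thesis using s1 s2 s3 s4 zero_le_power2[of t] zero_le_power2[of a] by linarith
    qed
    then have "N * (t\<^sup>2 * ((t + a)\<^sup>2 / 8)) \<le> N * (t\<^sup>2 * ((\<sigma> * t + 2 * tgt_x P)\<^sup>2 + a * (a + 2 * h) / 3))"
      using N by (intro mult_left_mono) auto
    also have "\<dots> = (\<Sum>n = 1..npos P. (t * (t - 2 * \<sigma> * u n))\<^sup>2)"
      unfolding power_mult_distrib[of t] using eq by (simp flip: sum_distrib_left)
    also have "N * (t\<^sup>2 * ((t + a)\<^sup>2 / 8)) = N * W\<^sup>2 / 8"
      unfolding t(2)[symmetric] by (simp add: power_mult_distrib)
    finally show ?thesis by (simp add: N_def)
  qed
  have "2 \<le> misfit P (tgt_x P + \<sigma> * t, tgt_y P, 0)"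
    using misfit_ge_two[OF P aL cL x0 y0 e, of "tgt_x P + \<sigma> * t" "tgt_y P"] near up low
    unfolding \<Delta> W_def q_def by blast
  moreover have "t \<le> 40 * (q * (Ldist P / apert P))"
  proof -
    have "t \<le> W / a" using tt pos by (simp add: field_simps)
    then show ?thesis by (simp add: W_def a_def)
  qed
  ultimately show ?thesis using t by blast
qed

text \<open>A displacement in range changes \<open>r\<^sub>n\<^sup>2\<close> by the same amount at
  every position, so the mean square is exactly \<open>W^2\<close>. The constant is 240 = 40 * 3 *
  2, from \<open>t * R <= 3 * W\<close> and \<open>offs P <= 2 * R\<close>.\<close>

lemma misfit_range:
  assumes P: "valid_scene P"
    and aL: "apert P \<le> Ldist P" and cL: "speed P / bandw P \<le> Ldist P"
    and x0: "\<bar>tgt_x P\<bar> \<le> apert P / 8" and y0: "\<bar>tgt_y P\<bar> \<le> offs P / 2"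
    and e: "sqrt (eps P) \<le> 1 / 10000"
    and \<sigma>: "\<sigma> \<in> {1, -1 :: real}"
  defines "q \<equiv> sqrt (eps P) * (speed P / bandw P)"
  shows "\<exists>t>0. t \<le> 240 * (q * (Ldist P / offs P)) \<and>
    2 \<le> misfit P (tgt_x P, tgt_y P + \<sigma> * t, 0)"
proof -
  define W where "W = 40 * (q * Ldist P)"
  define R where "R = offs P - tgt_y P"
  have pos: "0 < offs P" "2 \<le> npos P" "0 < speed P" "0 < bandw P" "0 < eps P"
    using P by (auto simp: valid_scene_def)
  have R: "0 < R" "offs P \<le> 2 * R" using y0 pos by (auto simp: R_def abs_le_iff)
  have \<sigma>2: "\<sigma> * \<sigma> = 1" using \<sigma> by auto
  have "0 < Ldist P" using pos by (simp add: Ldist_def add_pos_nonneg)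
  then have W: "0 < W" using pos by (simp add: W_def q_def)
  obtain t where t: "0 < t" "\<bar>t * (t - 2 * \<sigma> * R)\<bar> = W" "t * R \<le> 3 * W" "t\<^sup>2 \<le> 9 * W"
    using range_root[OF R(1) W \<sigma>] by blast
  have \<Delta>: "(dist (pos P n) (tgt_x P, tgt_y P + \<sigma> * t, 0))\<^sup>2 - (dist (pos P n) (target P))\<^sup>2 =
      t * (t - 2 * \<sigma> * R)" for n
  proof -
    have "(dist (pos P n) (tgt_x P, tgt_y P + \<sigma> * t, 0))\<^sup>2 - (dist (pos P n) (target P))\<^sup>2 =
        (R - \<sigma> * t)\<^sup>2 - R\<^sup>2"
      unfolding target_def pos_def dist_triple_sq by (simp add: R_def algebra_simps)
    also have "\<dots> = (\<sigma> * \<sigma>) * t * t - 2 * \<sigma> * t * R"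
      by (simp add: power2_eq_square algebra_simps)
    finally show ?thesis using \<sigma>2 by (simp add: algebra_simps)
  qed
  have near: "(dist (tgt_x P, tgt_y P + \<sigma> * t, 0) (target P))\<^sup>2 \<le> 9 * W"
  proof -
    have "(dist (tgt_x P, tgt_y P + \<sigma> * t, 0) (target P))\<^sup>2 = (\<sigma> * \<sigma>) * t * t"
      unfolding target_def dist_triple_sq by (simp add: power2_eq_square algebra_simps)
    then show ?thesis using t \<sigma>2 by (simp add: power2_eq_square)
  qed
  have up: "\<bar>t * (t - 2 * \<sigma> * R)\<bar> \<le> 2 * W" using t W by simp
  have low: "real (npos P) * W\<^sup>2 / 8 \<le> (\<Sum>n = 1..npos P. (t * (t - 2 * \<sigma> * R))\<^sup>2)"
  proof -
    have "(t * (t - 2 * \<sigma> * R))\<^sup>2 = W\<^sup>2" using t(2) by (metis power2_abs)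
    then show ?thesis by simp
  qed
  have "2 \<le> misfit P (tgt_x P, tgt_y P + \<sigma> * t, 0)"
    using misfit_ge_two[OF P aL cL x0 y0 e, of "tgt_x P" "tgt_y P + \<sigma> * t"] near up low
    unfolding \<Delta> W_def q_def by blast
  moreover have "t \<le> 240 * (q * (Ldist P / offs P))"
  proof -
    have "t * offs P \<le> t * (2 * R)" using R t by (intro mult_left_mono) auto
    then have "t * offs P \<le> 6 * W" using t(3) by linarith
    then have "t \<le> 6 * W / offs P" using pos by (simp add: field_simps)
    then show ?thesis by (simp add: W_def)
  qed
  ultimately show ?thesis using t(1) by blast
qed

section \<open>From bounds for a single scene to the asymptotic regime\<close>

definition small_scene :: "scene \<Rightarrow> bool" where
  "small_scene P \<longleftrightarrow> apert P \<le> Ldist P \<and> speed P / bandw P \<le> Ldist P \<and>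
     \<bar>tgt_x P\<bar> \<le> apert P / 8 \<and> \<bar>tgt_y P\<bar> \<le> offs P / 2 \<and> sqrt (eps P) \<le> 1 / 10000"

lemma eventually_small_scene:
  assumes valid: "\<And>i. valid_scene (P i)" and reg: "asymptotic_regime \<F> P"
  shows "\<forall>\<^sub>F i in \<F>. small_scene (P i)"
proof -
  have lim: "((\<lambda>i. tgt_x (P i) / apert (P i)) \<longlongrightarrow> 0) \<F>"
      "((\<lambda>i. tgt_y (P i) / offs (P i)) \<longlongrightarrow> 0) \<F>" "((\<lambda>i. eps (P i)) \<longlongrightarrow> 0) \<F>"
    using reg unfolding asymptotic_regime_def by blast+
  have x0: "\<forall>\<^sub>F i in \<F>. \<bar>tgt_x (P i) / apert (P i)\<bar> < 1 / 8"
    using tendstoD[OF lim(1), of "1 / 8"] by (simp add: dist_real_def)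
  have y0: "\<forall>\<^sub>F i in \<F>. \<bar>tgt_y (P i) / offs (P i)\<bar> < 1 / 2"
    using tendstoD[OF lim(2), of "1 / 2"] by (simp add: dist_real_def)
  have e: "\<forall>\<^sub>F i in \<F>. \<bar>eps (P i)\<bar> < (1 / 10000)\<^sup>2"
    using tendstoD[OF lim(3), of "(1 / 10000)\<^sup>2"] by (simp add: dist_real_def)
  have "\<forall>\<^sub>F i in \<F>. apert (P i) \<le> Ldist (P i) \<and> speed (P i) / bandw (P i) \<le> Ldist (P i)"
    using reg unfolding asymptotic_regime_def by blast
  with x0 y0 e show ?thesis
  proof eventually_elim
    case (elim i)
    have "0 < apert (P i)" "0 < offs (P i)" "0 < eps (P i)" using valid[of i] by (auto simp: valid_scene_def)
    moreover from this have "sqrt (eps (P i)) \<le> 1 / 10000"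
      using elim by (intro real_le_lsqrt) auto
    ultimately show ?case using elim by (simp add: small_scene_def abs_divide field_simps)
  qed
qed

lemma dist_pos_target_ge:
  assumes P: "valid_scene P" and y0: "\<bar>tgt_y P\<bar> \<le> offs P / 2"
  shows "Ldist P / 2 \<le> dist (pos P n) (target P)"
proof (rule power2_le_imp_le)
  have "(offs P / 2)\<^sup>2 \<le> (offs P - tgt_y P)\<^sup>2"
    using y0 P by (intro power_mono) (auto simp: valid_scene_def)
  then have "(offs P)\<^sup>2 / 4 \<le> (offs P - tgt_y P)\<^sup>2" by (simp add: power_divide)
  moreover obtain p where p: "(dist (pos P n) (target P))\<^sup>2 = p\<^sup>2 + (offs P - tgt_y P)\<^sup>2 + (height P)\<^sup>2"
    unfolding pos_def target_def dist_triple_sq by simp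
  moreover have L: "(Ldist P / 2)\<^sup>2 = (offs P)\<^sup>2 / 4 + (height P)\<^sup>2 / 4"
    by (simp add: Ldist_def power_divide add_divide_distrib)
  ultimately show "(Ldist P / 2)\<^sup>2 \<le> (dist (pos P n) (target P))\<^sup>2"
    unfolding p L using zero_le_power2[of p] zero_le_power2[of "height P"] by linarith
qed simp

text \<open>\<open>misfit >= 2\<close> means that the image is at most half its peak, so continuity
  puts the first crossing no later than that displacement. The curve \<open>f\<close>,
  \<open>g\<close> stands for either search direction.\<close>

lemma half_width_bigo:
  fixes w :: "'i \<Rightarrow> real"
  assumes half: "\<forall>\<^sub>F i in \<F>. \<exists>t>0. t \<le> C * w i \<and> 2 \<le> misfit (P i) (f i t, g i t, 0)"
    and valid: "\<And>i. valid_scene (P i)"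
    and img: "\<And>i x y. J i (x, y, 0) = cmod (reflectivity (P i)) / misfit (P i) (x, y, 0)"
    and cont: "\<And>i. continuous_on UNIV (f i)" "\<And>i. continuous_on UNIV (g i)"
    and start: "\<And>i. (f i 0, g i 0, 0) = target (P i)"
  shows "\<exists>dx. (\<forall>\<^sub>F i in \<F>. first_hit (\<lambda>t. J i (f i t, g i t, 0)) (cmod (reflectivity (P i)) / 2) (dx i)) \<and>
    dx \<in> O[\<F>](w)"
proof -
  define Q where "Q i t \<longleftrightarrow> first_hit (\<lambda>t. J i (f i t, g i t, 0)) (cmod (reflectivity (P i)) / 2) t \<and>
      \<bar>t\<bar> \<le> \<bar>C\<bar> * \<bar>w i\<bar>" for i t
  have ev: "\<forall>\<^sub>F i in \<F>. \<exists>t. Q i t"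
    using half
  proof eventually_elim
    case (elim i)
    then obtain b where b: "0 < b" "b \<le> C * w i" "2 \<le> misfit (P i) (f i b, g i b, 0)" by blast
    have \<rho>: "0 < cmod (reflectivity (P i))" using valid[of i] by (auto simp: valid_scene_def)
    have "misfit (P i) (f i t, g i t, 0) \<noteq> 0" for t
      using misfit_pos[OF valid[of i], of "f i t" "g i t"] by linarith
    then have "continuous_on {0..b} (\<lambda>t. J i (f i t, g i t, 0))"
      unfolding img using cont[of i]
      by (intro continuous_on_divide continuous_on_const continuous_on_misfit[OF valid])
        (auto intro: continuous_on_subset)
    moreover have "J i (f i 0, g i 0, 0) = cmod (reflectivity (P i))"
      unfolding img using start[of i] misfit_target[OF valid[of i]] by simp
    moreover have "J i (f i b, g i b, 0) \<le> cmod (reflectivity (P i)) / 2"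
      unfolding img using b \<rho> by (intro frac_le) auto
    ultimately obtain t where t: "t \<le> b"
        "first_hit (\<lambda>t. J i (f i t, g i t, 0)) (cmod (reflectivity (P i)) / 2) t"
      using first_hit_exists[of b "\<lambda>t. J i (f i t, g i t, 0)" "cmod (reflectivity (P i)) / 2"] b \<rho>
      by auto
    have "0 < t" using t(2) by (simp add: first_hit_def)
    moreover have "t \<le> \<bar>C\<bar> * \<bar>w i\<bar>"
      using t(1) b(2) abs_ge_self[of "C * w i"] unfolding abs_mult by linarith
    ultimately have "Q i t" using t(2) by (simp add: Q_def)
    then show ?case ..
  qed
  \<comment> \<open>Where no such \<open>t\<close> exists the value is arbitrary; this does not
    affect eventual statements.\<close>
  define dx where "dx i = (SOME t. Q i t)" for i
  have dx: "\<forall>\<^sub>F i in \<F>. Q i (dx i)"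
    using ev by eventually_elim (simp add: dx_def someI_ex)
  have "\<forall>\<^sub>F i in \<F>. first_hit (\<lambda>t. J i (f i t, g i t, 0)) (cmod (reflectivity (P i)) / 2) (dx i)"
    using dx by eventually_elim (simp add: Q_def)
  moreover have "dx \<in> O[\<F>](w)"
    by (rule bigoI[of _ "\<bar>C\<bar>"], use dx in eventually_elim) (simp add: Q_def)
  ultimately show ?thesis by blast
qed

lemma divide_misfit_le_max_ratio:
  assumes P: "valid_scene P" and \<rho>: "0 \<le> \<rho>"
  shows "\<rho> / misfit P (x, y, 0) \<le> \<rho> *
    (MAX n\<in>{1..npos P}. (dist (pos P n) (x, y, 0) / dist (pos P n) (target P))\<^sup>2)"
proof -
  let ?m = "MAX n\<in>{1..npos P}. (dist (pos P n) (x, y, 0) / dist (pos P n) (target P))\<^sup>2"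
  have "\<rho> / misfit P (x, y, 0) \<le> \<rho> / (1 / ?m)"
    using misfit_ge[OF P, of x y] Max_ratio_pos[OF P, of x y] \<rho> by (intro frac_le) auto
  then show ?thesis by simp
qed

text \<open>Triangle inequality: \<open>r <= d + D\<close>, and
  \<open>D <= \<delta> * L / 2 <= \<delta> * d\<close> because \<open>d >= L / 2\<close>.\<close>

lemma max_ratio_le_near:
  assumes P: "valid_scene P" and y0: "\<bar>tgt_y P\<bar> \<le> offs P / 2"
    and near: "dist (x, y, 0) (target P) \<le> D" and D: "D \<le> \<delta> / 2 * Ldist P"
  shows "(MAX n\<in>{1..npos P}. (dist (pos P n) (x, y, 0) / dist (pos P n) (target P))\<^sup>2) \<le> (1 + \<delta>)\<^sup>2"
proof -
  have ne: "{1..npos P} \<noteq> {}" using P by (auto simp: valid_scene_def)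
  have L: "0 < Ldist P" using P by (simp add: Ldist_def valid_scene_def add_pos_nonneg)
  have "0 \<le> \<delta> / 2 * Ldist P" using near D zero_le_dist[of "(x, y, 0)" "target P"] by linarith
  then have \<delta>: "0 \<le> \<delta>" using L by (simp add: zero_le_mult_iff)
  have "(dist (pos P n) (x, y, 0) / dist (pos P n) (target P))\<^sup>2 \<le> (1 + \<delta>)\<^sup>2" for n
  proof (rule power_mono)
    define d where "d = dist (pos P n) (target P)"
    have d: "Ldist P / 2 \<le> d" "0 < d"
      using dist_pos_target_ge[OF P y0] dist_pos_target[OF P] by (auto simp: d_def)
    have "\<delta> * (Ldist P / 2) \<le> \<delta> * d" using d \<delta> by (intro mult_left_mono)
    then have "D \<le> \<delta> * d" using D by simp
    moreover have "dist (pos P n) (x, y, 0) \<le> d + D"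
      using near dist_triangle[of "pos P n" "(x, y, 0)" "target P"] dist_commute[of "target P" "(x, y, 0)"]
      unfolding d_def by linarith
    ultimately have "dist (pos P n) (x, y, 0) \<le> (1 + \<delta>) * d" unfolding distrib_right by linarith
    then show "dist (pos P n) (x, y, 0) / dist (pos P n) (target P) \<le> 1 + \<delta>"
      using d by (simp add: pos_divide_le_eq flip: d_def)
  qed simp
  then show ?thesis using ne by (intro Max.boundedI) auto
qed

theorem theorem5p1:
  fixes P :: "'i \<Rightarrow> scene"
    and U V :: "'i \<Rightarrow> nat \<Rightarrow> complex mat"
    and s :: "'i \<Rightarrow> nat \<Rightarrow> nat \<Rightarrow> real"
    and \<F> :: "'i filter"
  assumes valid: "\<And>i. valid_scene (P i)"
    and svd: "\<And>i n. n \<in> {1..npos (P i)} \<Longrightarrow>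
      is_svd (nfreq (P i)) (prony (P i) n) (U i n) (s i n) (V i n)"
    and snr: "\<And>i n. n \<in> {1..npos (P i)} \<Longrightarrow> signal_separated (nfreq (P i)) (s i n)"
  shows
    "(\<forall>i. sar_image (P i) (U i) (s i) (target (P i)) = cmod (reflectivity (P i)) \<and>
        (\<forall>x y. sar_image (P i) (U i) (s i) (x, y, 0) \<le> cmod (reflectivity (P i)) *
           (MAX n\<in>{1..npos (P i)}.
              (dist (pos (P i) n) (x, y, 0) / dist (pos (P i) n) (target (P i)))\<^sup>2))) \<and>
     (asymptotic_regime \<F> P \<longrightarrow>
        (\<forall>D. ((\<lambda>i. D i / Ldist (P i)) \<longlongrightarrow> 0) \<F> \<longrightarrow>
           (\<forall>\<eta>>0. \<forall>\<^sub>F i in \<F>. \<forall>x y. dist (x, y, 0) (target (P i)) \<le> D i \<longrightarrow>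
              sar_image (P i) (U i) (s i) (x, y, 0) \<le> (1 + \<eta>) * cmod (reflectivity (P i)))) \<and>
        (\<forall>\<sigma>\<in>{1, -1}. \<exists>dx.
           (\<forall>\<^sub>F i in \<F>. first_hit
              (\<lambda>t. sar_image (P i) (U i) (s i) (tgt_x (P i) + \<sigma> * t, tgt_y (P i), 0))
              (cmod (reflectivity (P i)) / 2) (dx i)) \<and>
           dx \<in> O[\<F>](\<lambda>i. sqrt (eps (P i)) * (speed (P i) / bandw (P i)) *
                            (Ldist (P i) / apert (P i)))) \<and>
        (\<forall>\<sigma>\<in>{1, -1}. \<exists>dy.
           (\<forall>\<^sub>F i in \<F>. first_hit
              (\<lambda>t. sar_image (P i) (U i) (s i) (tgt_x (P i), tgt_y (P i) + \<sigma> * t, 0))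
              (cmod (reflectivity (P i)) / 2) (dy i)) \<and>
           dy \<in> O[\<F>](\<lambda>i. sqrt (eps (P i)) * (speed (P i) / bandw (P i)) *
                            (Ldist (P i) / offs (P i)))))"
proof (intro conjI allI impI ballI)
  have img: "sar_image (P i) (U i) (s i) (x, y, 0) =
      cmod (reflectivity (P i)) / misfit (P i) (x, y, 0)" for i x y
    by (rule sar_image_eq[where V = "V i"]) (use valid svd snr in auto)
  show "sar_image (P i) (U i) (s i) (target (P i)) = cmod (reflectivity (P i))" for i
    using img[of i "tgt_x (P i)" "tgt_y (P i)"] misfit_target[OF valid[of i]]
    by (simp add: target_def)
  show le_max: "sar_image (P i) (U i) (s i) (x, y, 0) \<le> cmod (reflectivity (P i)) *
      (MAX n\<in>{1..npos (P i)}. (dist (pos (P i) n) (x, y, 0) / dist (pos (P i) n) (target (P i)))\<^sup>2)"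
    for i x y
    unfolding img by (rule divide_misfit_le_max_ratio[OF valid norm_ge_zero])
  assume reg: "asymptotic_regime \<F> P"
  note small = eventually_small_scene[OF valid reg]
  show "\<forall>\<^sub>F i in \<F>. \<forall>x y. dist (x, y, 0) (target (P i)) \<le> D i \<longrightarrow>
      sar_image (P i) (U i) (s i) (x, y, 0) \<le> (1 + \<eta>) * cmod (reflectivity (P i))"
    if D: "((\<lambda>i. D i / Ldist (P i)) \<longlongrightarrow> 0) \<F>" and \<eta>: "0 < \<eta>" for D and \<eta> :: real
  proof -
    \<comment> \<open>\<open>\<delta> <= 1\<close> gives
      \<open>(1 + \<delta>)^2 <= 1 + 3 * \<delta>\<close>, whence the third of
      \<open>\<eta>\<close>.\<close>
    define \<delta> where "\<delta> = min 1 (\<eta> / 3)"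
    have \<delta>: "0 < \<delta>" "\<delta> \<le> 1" "3 * \<delta> \<le> \<eta>" using \<eta> by (auto simp: \<delta>_def)
    have "\<delta> * \<delta> \<le> \<delta>" using \<delta> by (intro mult_left_le) auto
    moreover have "(1 + \<delta>)\<^sup>2 = 1 + 2 * \<delta> + \<delta> * \<delta>" by (simp add: power2_eq_square algebra_simps)
    ultimately have \<delta>2: "(1 + \<delta>)\<^sup>2 \<le> 1 + \<eta>" using \<delta> by linarith
    have "\<forall>\<^sub>F i in \<F>. \<bar>D i / Ldist (P i)\<bar> < \<delta> / 2"
      using tendstoD[OF D, of "\<delta> / 2"] \<delta> by (simp add: dist_real_def)
    with small show ?thesis
    proof eventually_elim
      case (elim i)
      have L: "0 < Ldist (P i)" using valid[of i] by (simp add: Ldist_def valid_scene_def add_pos_nonneg)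
      have "D i / Ldist (P i) \<le> \<delta> / 2" using elim(2) by linarith
      then have D: "D i \<le> \<delta> / 2 * Ldist (P i)" using L by (simp add: pos_divide_le_eq)
      have y0: "\<bar>tgt_y (P i)\<bar> \<le> offs (P i) / 2" using elim(1) by (simp add: small_scene_def)
      show ?case
      proof (intro allI impI)
        fix x y assume "dist (x, y, 0) (target (P i)) \<le> D i"
        from max_ratio_le_near[OF valid y0 this D] \<delta>2
        have "cmod (reflectivity (P i)) * (MAX n\<in>{1..npos (P i)}.
            (dist (pos (P i) n) (x, y, 0) / dist (pos (P i) n) (target (P i)))\<^sup>2) \<le>
            cmod (reflectivity (P i)) * (1 + \<eta>)"
          by (intro mult_left_mono) auto
        with le_max[of i x y]
        show "sar_image (P i) (U i) (s i) (x, y, 0) \<le> (1 + \<eta>) * cmod (reflectivity (P i))"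
          by (simp add: mult.commute)
      qed
    qed
  qed
  fix \<sigma> :: real assume \<sigma>: "\<sigma> \<in> {1, -1}"
  show "\<exists>dx. (\<forall>\<^sub>F i in \<F>. first_hit
        (\<lambda>t. sar_image (P i) (U i) (s i) (tgt_x (P i) + \<sigma> * t, tgt_y (P i), 0))
        (cmod (reflectivity (P i)) / 2) (dx i)) \<and>
      dx \<in> O[\<F>](\<lambda>i. sqrt (eps (P i)) * (speed (P i) / bandw (P i)) * (Ldist (P i) / apert (P i)))"
  proof (rule half_width_bigo[where P = P and C = 40 and f = "\<lambda>i t. tgt_x (P i) + \<sigma> * t"
        and g = "\<lambda>i t. tgt_y (P i)", OF _ valid img])
    show "\<forall>\<^sub>F i in \<F>. \<exists>t>0. t \<le> 40 * (sqrt (eps (P i)) * (speed (P i) / bandw (P i)) *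
        (Ldist (P i) / apert (P i))) \<and> 2 \<le> misfit (P i) (tgt_x (P i) + \<sigma> * t, tgt_y (P i), 0)"
      using small by eventually_elim (rule misfit_cross_range[OF valid _ _ _ _ _ \<sigma>], auto simp: small_scene_def)
  qed (auto simp: target_def intro!: continuous_intros)
  show "\<exists>dy. (\<forall>\<^sub>F i in \<F>. first_hit
        (\<lambda>t. sar_image (P i) (U i) (s i) (tgt_x (P i), tgt_y (P i) + \<sigma> * t, 0))
        (cmod (reflectivity (P i)) / 2) (dy i)) \<and>
      dy \<in> O[\<F>](\<lambda>i. sqrt (eps (P i)) * (speed (P i) / bandw (P i)) * (Ldist (P i) / offs (P i)))"
  proof (rule half_width_bigo[where P = P and C = 240 and f = "\<lambda>i t. tgt_x (P i)"
        and g = "\<lambda>i t. tgt_y (P i) + \<sigma> * t", OF _ valid img])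
    show "\<forall>\<^sub>F i in \<F>. \<exists>t>0. t \<le> 240 * (sqrt (eps (P i)) * (speed (P i) / bandw (P i)) *
        (Ldist (P i) / offs (P i))) \<and> 2 \<le> misfit (P i) (tgt_x (P i), tgt_y (P i) + \<sigma> * t, 0)"
      using small by eventually_elim (rule misfit_range[OF valid _ _ _ _ _ \<sigma>], auto simp: small_scene_def)
  qed (auto simp: target_def intro!: continuous_intros)
qed

end
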